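(* Let $\Sigma=(A,G,\alpha,\sigma)$ be a twisted unital discrete C$^*$-dynamical system and assume that $G$ belongs to the class $\mathcal{P}$. Then $\Sigma$ has property (DP).
   Context: A twisted unital discrete C$^*$-dynamical system $\Sigma=(A,G,\alpha,\sigma)$ consists of a unital C$^*$-algebra $A$, a discrete group $G$ with identity $e$, and maps $\alpha:G\to\mathrm{Aut}(A)$, $\sigma:G\times G\to\mathcal{U}(A)$ (the unitary group of $A$) such that for all $g,h,k\in G$: $\alpha_g\circ\alpha_h=\mathrm{Ad}(\sigma(g,h))\circ\alpha_{gh}$, $\sigma(g,h)\sigma(gh,k)=\alpha_g(\sigma(h,k))\sigma(g,hk)$, $\sigma(g,e)=\sigma(e,g)=1$. The reduced crossed product $C_r^*(\Sigma)$ is characterized up to isomorphism as follows: it is a C$^*$-algebra generated by (a copy of) $A$ and unitaries $\{\lambda(g)\mid g\in G\}$ with $\alpha_g(a)=\lambda(g)a\lambda(g)^*$ and $\lambda(g)\lambda(h)=\sigma(g,h)\lambda(gh)$ for all $g,h\in G$, $a\in A$, and there is a faithful conditional expectation $E:C_r^*(\Sigma)\to A$ with $E(\lambda(g))=0$ for all $g\ne e$. Property (DP): $\Sigma$ has property (DP) if for every $y\in C_r^*(\Sigma)$ with $y^*=y$ and $E(y)=0$, the element $0$ belongs to the norm closure of the convex hull of $\{vyv^*\mid v\in\mathcal{U}(C_r^*(\Sigma))\}$. The class $\mathcal{P}$ consists of all discrete groups that are PH groups or have property $(P_{\rm com})$, defined as follows ($\mathbb{N}=\{1,2,\dots\}$).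 PH groups: For $g\in G$ and $S\subset G$ put $\langle g\rangle_S=\{sgs^{-1}\mid s\in S\}$. If $T\subset G$ and $\emptyset\ne M\subset G\setminus\{e\}$, $T$ is $M$-large if $m(G\setminus T)\subset T$ for all $m\in M$. If $\emptyset\ne F\subset G\setminus\{e\}$ and $H\subset G$, $H$ is a Powers set for $F$ if for any $N\in\mathbb{N}$ there exist $h_1,\dots,h_N\in H$ and pairwise disjoint subsets $T_1,\dots,T_N$ of $G$ such that $T_j$ is $h_jFh_j^{-1}$-large for $j=1,\dots,N$. If $g\in G\setminus\{e\}$, $H$ is a c-Powers set for $g$ if $H$ is a Powers set for $\langle g\rangle_M$ for all finite non-empty subsets $M$ of $H$. $G$ is a PH group if, given any finite non-empty subset $F$ of $G\setminus\{e\}$, one can write $F=\{f_1,\dots,f_n\}$ and find a chain of subgroups $G_1\subset G_2\subset\cdots\subset G_n\subset G$ such that $G_j$ is a c-Powers set for $f_j$, $j=1,\dots,n$. Property $(P_{\rm com})$: for any non-empty finite subset $F\subset G\setminus\{e\}$ there exist $n\in\mathbb{N}$, $g_0\in G$ and subsets $U,D_1,\dots,D_n$ of $G$ such that (i) $G\setminus U\subset D_1\cup\cdots\cup D_n$; (ii) $gU\cap U=\emptyset$ for all $g\in F$; (iii) $g_0^{-j}D_k\cap D_k=\emptyset$ for all $j\in\mathbb{N}$ and $k=1,\dots,n$. *)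

theory Defs
  imports "HOL-Analysis.Analysis" "HOL-Algebra.Coset" "HOL-Library.Disjoint_Sets"
begin

section \<open>Unital C*-algebras\<close>

text \<open>
  The unit is only required to be a multiplicative identity (class \<^class>\<open>monoid_mult\<close> rather
  than \<^class>\<open>real_normed_algebra_1\<close>), so the zero algebra is a unital C*-algebra.
\<close>

class unital_cstar_algebra = real_normed_algebra + banach + monoid_mult +
  fixes scaleC :: "complex \<Rightarrow> 'a \<Rightarrow> 'a"  (infixr "*\<^sub>C" 75)
    and adj :: "'a \<Rightarrow> 'a"
  assumes scaleC_add_right: "c *\<^sub>C (x + y) = c *\<^sub>C x + c *\<^sub>C y"
    and scaleC_add_left: "(c + d) *\<^sub>C x = c *\<^sub>C x + d *\<^sub>C x"
    and scaleC_scaleC: "c *\<^sub>C (d *\<^sub>C x) = (c * d) *\<^sub>C x"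
    and scaleR_scaleC: "r *\<^sub>R x = complex_of_real r *\<^sub>C x"
    and scaleC_mult_left: "(c *\<^sub>C x) * y = c *\<^sub>C (x * y)"
    and scaleC_mult_right: "x * (c *\<^sub>C y) = c *\<^sub>C (x * y)"
    and norm_scaleC: "norm (c *\<^sub>C x) = cmod c * norm x"
    and adj_adj: "adj (adj x) = x"
    and adj_add: "adj (x + y) = adj x + adj y"
    and adj_scaleC: "adj (c *\<^sub>C x) = cnj c *\<^sub>C adj x"
    and adj_mult: "adj (x * y) = adj y * adj x"
    and cstar_identity: "norm (adj x * x) = (norm x)\<^sup>2"

definition unitaries :: "'a::unital_cstar_algebra set"
  where "unitaries = {v. adj v * v = 1 \<and> v * adj v = 1}"

definition cstar_pos :: "'a::unital_cstar_algebra \<Rightarrow> bool"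
  where "cstar_pos a \<longleftrightarrow> (\<exists>c. a = adj c * c)"

definition clinear_map :: "('a::unital_cstar_algebra \<Rightarrow> 'b::unital_cstar_algebra) \<Rightarrow> bool"
  where "clinear_map f \<longleftrightarrow>
    (\<forall>x y. f (x + y) = f x + f y) \<and> (\<forall>c x. f (c *\<^sub>C x) = c *\<^sub>C f x)"

definition unital_star_hom :: "('a::unital_cstar_algebra \<Rightarrow> 'b::unital_cstar_algebra) \<Rightarrow> bool"
  where "unital_star_hom f \<longleftrightarrow> clinear_map f \<and> f 1 = 1 \<and>
    (\<forall>x y. f (x * y) = f x * f y) \<and> (\<forall>x. f (adj x) = adj (f x))"

definition star_automorphism :: "('a::unital_cstar_algebra \<Rightarrow> 'a) \<Rightarrow> bool"
  where "star_automorphism f \<longleftrightarrow> unital_star_hom f \<and> bij f"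

definition cstar_subalgebra :: "'a::unital_cstar_algebra set \<Rightarrow> bool"
  where "cstar_subalgebra S \<longleftrightarrow> closed S \<and> 0 \<in> S \<and>
    (\<forall>x\<in>S. \<forall>y\<in>S. x + y \<in> S \<and> x * y \<in> S) \<and>
    (\<forall>c. \<forall>x\<in>S. c *\<^sub>C x \<in> S) \<and> (\<forall>x\<in>S. adj x \<in> S)"

text \<open>
  Here \<open>\<iota>\<close> embeds the algebra \<open>'a\<close> in \<open>'b\<close>, and the expectation takes its values in \<open>'a\<close> itself
  instead of in \<open>range \<iota>\<close>.
\<close>

definition conditional_expectation ::
    "('a::unital_cstar_algebra \<Rightarrow> 'b::unital_cstar_algebra) \<Rightarrow> ('b \<Rightarrow> 'a) \<Rightarrow> bool"
  where "conditional_expectation \<iota> E \<longleftrightarrow> clinear_map E \<and>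
    (\<forall>a. E (\<iota> a) = a) \<and>
    (\<forall>a b x. E (\<iota> a * x * \<iota> b) = a * E x * b) \<and>
    (\<forall>x. cstar_pos x \<longrightarrow> cstar_pos (E x)) \<and>
    (\<forall>x. norm (E x) \<le> norm x)"

definition faithful_map :: "('b::unital_cstar_algebra \<Rightarrow> 'a::unital_cstar_algebra) \<Rightarrow> bool"
  where "faithful_map E \<longleftrightarrow> (\<forall>x. E (adj x * x) = 0 \<longrightarrow> x = 0)"

section \<open>Twisted C*-dynamical systems and reduced crossed products\<close>

locale twisted_cstar_system = group G
  for G :: "('g, 'm) monoid_scheme" (structure)
    and \<alpha> :: "'g \<Rightarrow> 'a::unital_cstar_algebra \<Rightarrow> 'a"
    and \<sigma> :: "'g \<Rightarrow> 'g \<Rightarrow> 'a" +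
  assumes alpha_aut: "g \<in> carrier G \<Longrightarrow> star_automorphism (\<alpha> g)"
    and sigma_unitary: "g \<in> carrier G \<Longrightarrow> h \<in> carrier G \<Longrightarrow> \<sigma> g h \<in> unitaries"
    and alpha_alpha: "g \<in> carrier G \<Longrightarrow> h \<in> carrier G \<Longrightarrow>
      \<alpha> g (\<alpha> h a) = \<sigma> g h * \<alpha> (g \<otimes> h) a * adj (\<sigma> g h)"
    and sigma_cocycle: "g \<in> carrier G \<Longrightarrow> h \<in> carrier G \<Longrightarrow> k \<in> carrier G \<Longrightarrow>
      \<sigma> g h * \<sigma> (g \<otimes> h) k = \<alpha> g (\<sigma> h k) * \<sigma> g (h \<otimes> k)"
    and sigma_one_right: "g \<in> carrier G \<Longrightarrow> \<sigma> g \<one> = 1"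
    and sigma_one_left: "g \<in> carrier G \<Longrightarrow> \<sigma> \<one> g = 1"

text \<open>
  The reduced crossed product is given by its characterization up to isomorphism: the algebra
  \<open>'b\<close>, the embedding \<open>\<iota>\<close>, the unitaries \<open>lam g\<close> and the expectation \<open>E\<close> form a realization of it.
\<close>

locale reduced_crossed_product = twisted_cstar_system G \<alpha> \<sigma>
  for G :: "('g, 'm) monoid_scheme" (structure)
    and \<alpha> :: "'g \<Rightarrow> 'a::unital_cstar_algebra \<Rightarrow> 'a"
    and \<sigma> :: "'g \<Rightarrow> 'g \<Rightarrow> 'a"
    and \<iota> :: "'a \<Rightarrow> 'b::unital_cstar_algebra"
    and lam :: "'g \<Rightarrow> 'b"
    and E :: "'b \<Rightarrow> 'a" +
  assumes iota_hom: "unital_star_hom \<iota>"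
    and iota_inj: "inj \<iota>"
    and lam_unitary: "g \<in> carrier G \<Longrightarrow> lam g \<in> unitaries"
    and generated: "cstar_subalgebra hull (range \<iota> \<union> lam ` carrier G) = UNIV"
    and lam_covariant: "g \<in> carrier G \<Longrightarrow> \<iota> (\<alpha> g a) = lam g * \<iota> a * adj (lam g)"
    and lam_lam: "g \<in> carrier G \<Longrightarrow> h \<in> carrier G \<Longrightarrow> lam g * lam h = \<iota> (\<sigma> g h) * lam (g \<otimes> h)"
    and E_expectation: "conditional_expectation \<iota> E"
    and E_faithful: "faithful_map E"
    and E_lam: "g \<in> carrier G \<Longrightarrow> g \<noteq> \<one> \<Longrightarrow> E (lam g) = 0"

text \<open>
  Property (DP) is formulated for the canonical expectation \<open>E\<close> of a realization \<open>'b\<close> of the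
  reduced crossed product.
\<close>

definition property_DP :: "('b::unital_cstar_algebra \<Rightarrow> 'a::unital_cstar_algebra) \<Rightarrow> bool"
  where "property_DP E \<longleftrightarrow>
    (\<forall>y. adj y = y \<and> E y = 0 \<longrightarrow>
      0 \<in> closure (convex hull {v * y * adj v | v. v \<in> unitaries}))"

section \<open>The class of groups\<close>

text \<open>
  Inclusions of subsets are not required to be strict, and natural numbers used as sizes or
  exponents start at 1.
\<close>

definition conjugates ::
    "('g, 'm) monoid_scheme \<Rightarrow> 'g \<Rightarrow> 'g set \<Rightarrow> 'g set"
  where "conjugates G g S = {s \<otimes>\<^bsub>G\<^esub> g \<otimes>\<^bsub>G\<^esub> inv\<^bsub>G\<^esub> s | s. s \<in> S}"

definition large_set :: "('g, 'm) monoid_scheme \<Rightarrow> 'g set \<Rightarrow> 'g set \<Rightarrow> bool"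
  where "large_set G M T \<longleftrightarrow> M \<noteq> {} \<and> M \<subseteq> carrier G - {\<one>\<^bsub>G\<^esub>} \<and> T \<subseteq> carrier G \<and>
    (\<forall>m\<in>M. m <#\<^bsub>G\<^esub> (carrier G - T) \<subseteq> T)"

definition powers_set :: "('g, 'm) monoid_scheme \<Rightarrow> 'g set \<Rightarrow> 'g set \<Rightarrow> bool"
  where "powers_set G F H \<longleftrightarrow> F \<noteq> {} \<and> F \<subseteq> carrier G - {\<one>\<^bsub>G\<^esub>} \<and> H \<subseteq> carrier G \<and>
    (\<forall>N::nat. N \<ge> 1 \<longrightarrow> (\<exists>(h :: nat \<Rightarrow> 'g) (T :: nat \<Rightarrow> 'g set).
      h ` {1..N} \<subseteq> H \<and> disjoint_family_on T {1..N} \<and>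
      (\<forall>j\<in>{1..N}. large_set G {h j \<otimes>\<^bsub>G\<^esub> f \<otimes>\<^bsub>G\<^esub> inv\<^bsub>G\<^esub> (h j) | f. f \<in> F} (T j))))"

definition c_powers_set :: "('g, 'm) monoid_scheme \<Rightarrow> 'g \<Rightarrow> 'g set \<Rightarrow> bool"
  where "c_powers_set G g H \<longleftrightarrow> g \<in> carrier G - {\<one>\<^bsub>G\<^esub>} \<and> H \<subseteq> carrier G \<and>
    (\<forall>M. finite M \<and> M \<noteq> {} \<and> M \<subseteq> H \<longrightarrow> powers_set G (conjugates G g M) H)"

definition PH_group :: "('g, 'm) monoid_scheme \<Rightarrow> bool"
  where "PH_group G \<longleftrightarrow> group G \<and>
    (\<forall>F. finite F \<and> F \<noteq> {} \<and> F \<subseteq> carrier G - {\<one>\<^bsub>G\<^esub>} \<longrightarrow>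
      (\<exists>(n::nat) (f :: nat \<Rightarrow> 'g) (K :: nat \<Rightarrow> 'g set).
        bij_betw f {1..n} F \<and>
        (\<forall>j\<in>{1..n}. subgroup (K j) G) \<and>
        (\<forall>j\<in>{1..<n}. K j \<subseteq> K (Suc j)) \<and>
        (\<forall>j\<in>{1..n}. c_powers_set G (f j) (K j))))"

definition P_com :: "('g, 'm) monoid_scheme \<Rightarrow> bool"
  where "P_com G \<longleftrightarrow> group G \<and>
    (\<forall>F. finite F \<and> F \<noteq> {} \<and> F \<subseteq> carrier G - {\<one>\<^bsub>G\<^esub>} \<longrightarrow>
      (\<exists>(n::nat) g0 U (D :: nat \<Rightarrow> 'g set).
        n \<ge> 1 \<and> g0 \<in> carrier G \<and> U \<subseteq> carrier G \<and> (\<forall>k\<in>{1..n}. D k \<subseteq> carrier G) \<and>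
        carrier G - U \<subseteq> (\<Union>k\<in>{1..n}. D k) \<and>
        (\<forall>g\<in>F. (g <#\<^bsub>G\<^esub> U) \<inter> U = {}) \<and>
        (\<forall>j::nat. j \<ge> 1 \<longrightarrow> (\<forall>k\<in>{1..n}.
          ((g0 [^]\<^bsub>G\<^esub> (- int j)) <#\<^bsub>G\<^esub> D k) \<inter> D k = {}))))"

definition class_P :: "('g, 'm) monoid_scheme \<Rightarrow> bool"
  where "class_P G \<longleftrightarrow> PH_group G \<or> P_com G"

end

theory Submission
  imports Defs
begin

text \<open>
  The crossed product is studied through the \<open>'a\<close>-valued inner product \<open>E (adj x * y)\<close>: the
  closed span of the \<open>lam g * \<iota> a\<close> is everything, parts with disjoint supports in \<open>G\<close> are
  orthogonal, and since \<open>E\<close> is faithful the norm of \<open>b\<close> is the operator norm of left multiplication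
  by \<open>b\<close> for this inner product. If \<open>y\<close> is supported on \<open>F\<close> and \<open>F\<close> maps the complement of \<open>T\<close>
  into \<open>T\<close>, then \<open>y\<close> compressed to the complement of \<open>T\<close> vanishes. Conjugating with \<open>N\<close> group
  elements for which the sets \<open>T\<close> overlap at most \<open>n\<close> times therefore gives a mean of norm at most
  \<open>2 * norm y * sqrt (n / N)\<close>. Both kinds of groups in the class provide such sets, PH groups for one
  element of the support at a time.
\<close>

section \<open>Square roots and positivity in C*-algebras\<close>

text \<open>Cutting a finitely supported element down to a subset of \<open>G\<close> is in general
  unbounded for the C*-norm, so the compressions cannot be formed inside the algebra. They exist
  only for the inner product: finitely supported vectors are split exactly, estimates are proved for
  them, and density together with closedness of the positive cone extends these to all vectors.
  Since the inner product takes values in an algebra, each scalar inequality of the Hilbert space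
  argument becomes an inequality of positive elements, mostly obtained by recognising a difference
  as \<open>adj k * k\<close> or a sum of such terms. Hence positivity is developed first, with
  commuting roots as its only tool.\<close>

lemma adj_zero [simp]: "adj (0::'a::unital_cstar_algebra) = 0"
  using adj_add[of "0::'a" 0] by simp

lemma adj_minus: "adj (- x) = - adj x"
  using adj_add[of x "- x"] by (simp add: eq_neg_iff_add_eq_0 add.commute)

lemma adj_diff: "adj (x - y) = adj x - adj y"
  using adj_add[of x "- y"] by (simp add: adj_minus)

lemma adj_one [simp]: "adj (1::'a::unital_cstar_algebra) = 1"
  using adj_mult[of "1::'a" "adj 1"] by (simp add: adj_adj)

lemma adj_scaleR: "adj (r *\<^sub>R x) = r *\<^sub>R adj x"
  by (simp add: scaleR_scaleC adj_scaleC)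

lemma adj_sum: "adj (sum f I) = (\<Sum>i\<in>I. adj (f i))"
  by (induction I rule: infinite_finite_induct) (simp_all add: adj_add)

lemma norm_adj [simp]: "norm (adj x) = norm (x::'a::unital_cstar_algebra)"
proof -
  have *: "norm x \<le> norm (adj x)" for x :: 'a
  proof (cases "norm x = 0")
    case False
    have "norm x * norm x \<le> norm (adj x) * norm x"
      using norm_mult_ineq[of "adj x" x] by (simp add: cstar_identity power2_eq_square)
    then show ?thesis using False by simp
  qed simp
  show ?thesis using *[of x] *[of "adj x"] by (simp add: adj_adj)
qed

text \<open>The C*-identity makes \<open>norm 1\<close> equal to its square, so it is 0 or 1; the
  value 0 occurs in the zero algebra, hence an inequality.\<close>

lemma norm_one_le: "norm (1::'a::unital_cstar_algebra) \<le> 1"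
  using cstar_identity[of "1::'a"] by (auto simp: power2_eq_square)

lemma norm_scaleR_one_le: "norm (r *\<^sub>R (1::'a::unital_cstar_algebra)) \<le> \<bar>r\<bar>"
  using norm_one_le[where 'a = 'a] by (simp add: mult_left_le)

lemma adj_mult_self_eq_0: "adj x * x = 0 \<longleftrightarrow> x = 0"
  using cstar_identity[of x] by auto

lemma selfadj_square_norm: "adj x = x \<Longrightarrow> norm (x * x) = (norm x)\<^sup>2"
  using cstar_identity[of x] by simp

lemma selfadj_square_eq_0: "adj x = x \<Longrightarrow> x * x = 0 \<longleftrightarrow> x = 0"
  using adj_mult_self_eq_0[of x] by simp

lemma bounded_linear_adj: "bounded_linear (adj :: 'a::unital_cstar_algebra \<Rightarrow> 'a)"
  by (rule bounded_linear_intro[where K = 1]) (simp_all add: adj_add adj_scaleR)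

section \<open>Square roots by iteration\<close>

text \<open>A fixed point \<open>y\<close> satisfies \<open>(1 - y) * (1 - y) = 1 - x\<close>, so
  the limit is 1 minus a square root of \<open>1 - x\<close>.\<close>

primrec sqrt_iter :: "'a::unital_cstar_algebra \<Rightarrow> nat \<Rightarrow> 'a" where
  "sqrt_iter x 0 = 0"
| "sqrt_iter x (Suc n) = (1/2) *\<^sub>R (x + sqrt_iter x n * sqrt_iter x n)"

text \<open>The same iteration for the number 1 in place of \<open>x\<close>; it serves as a
  majorant.\<close>

primrec sqrt_bound :: "nat \<Rightarrow> real" where
  "sqrt_bound 0 = 0"
| "sqrt_bound (Suc n) = (1 + sqrt_bound n * sqrt_bound n) / 2"

lemma sqrt_bound_range: "0 \<le> sqrt_bound n \<and> sqrt_bound n \<le> 1"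
  by (induction n) (auto intro: mult_le_one)

text \<open>The increment is half the square of \<open>1 - sqrt_bound n\<close>.\<close>

lemma sqrt_bound_mono: "sqrt_bound n \<le> sqrt_bound (Suc n)"
  using sum_squares_ge_zero[of "1 - sqrt_bound n" 0] by (simp add: algebra_simps)

lemma sqrt_bound_convergent: "convergent sqrt_bound"
proof (rule Bseq_monoseq_convergent)
  show "Bseq sqrt_bound"
    using sqrt_bound_range by (intro BseqI'[of _ 1]) auto
  show "monoseq sqrt_bound"
    using sqrt_bound_mono by (simp add: monoseq_Suc)
qed

text \<open>The iterates are polynomials in \<open>x\<close>, so a relation
  \<open>x * z = z * x'\<close> passes to them. With \<open>x' = x\<close> this is commutation; with
  different \<open>x'\<close> it later moves an absolute value across an element.\<close>

lemma sqrt_iter_intertwine: "x * z = z * x' \<Longrightarrow> sqrt_iter x n * z = z * sqrt_iter x' n"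
proof (induction n)
  case (Suc n)
  have "sqrt_iter x n * sqrt_iter x n * z = z * (sqrt_iter x' n * sqrt_iter x' n)"
    using Suc by (metis mult.assoc)
  with Suc.prems show ?case by (simp add: algebra_simps)
qed simp

lemma sqrt_iter_adj: "adj x = x \<Longrightarrow> adj (sqrt_iter x n) = sqrt_iter x n"
  by (induction n) (simp_all add: adj_scaleR adj_add adj_mult)

text \<open>As the iterates commute, the difference of two squares factors, and each increment is
  dominated by that of the scalar majorant.\<close>

lemma sqrt_iter_bounds:
  assumes "norm x \<le> 1"
  shows "norm (sqrt_iter x n) \<le> sqrt_bound n \<and>
    norm (sqrt_iter x (Suc n) - sqrt_iter x n) \<le> sqrt_bound (Suc n) - sqrt_bound n"
proof (induction n)
  case 0
  then show ?case using assms by simp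
next
  case (Suc n)
  let ?y = "sqrt_iter x n" and ?y' = "sqrt_iter x (Suc n)"
  let ?s = "sqrt_bound n" and ?s' = "sqrt_bound (Suc n)"
  have y': "norm ?y' \<le> ?s'"
    using norm_triangle_ineq[of "?y' - ?y" ?y] Suc by (simp del: sqrt_iter.simps sqrt_bound.simps)
  have comm: "?y * ?y' = ?y' * ?y"
  proof -
    have 1: "x * ?y = ?y * x"
      using sqrt_iter_intertwine[of x x x n] by simp
    show ?thesis
      using sqrt_iter_intertwine[OF 1, of "Suc n"] by simp
  qed
  have "sqrt_iter x (Suc (Suc n)) - ?y' = (1/2) *\<^sub>R (?y' * ?y' - ?y * ?y)"
    unfolding sqrt_iter.simps(2)[of x "Suc n"] by (subst sqrt_iter.simps(2)[of x n]) (simp add: scaleR_add_right scaleR_diff_right)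
  also have "?y' * ?y' - ?y * ?y = (?y' - ?y) * (?y' + ?y)"
    using comm by (simp add: algebra_simps del: sqrt_iter.simps)
  finally have "norm (sqrt_iter x (Suc (Suc n)) - ?y') = (1/2) * norm ((?y' - ?y) * (?y' + ?y))"
    by simp
  also have "\<dots> \<le> (1/2) * ((?s' - ?s) * (?s' + ?s))"
  proof -
    have "norm ((?y' - ?y) * (?y' + ?y)) \<le> norm (?y' - ?y) * norm (?y' + ?y)"
      by (rule norm_mult_ineq)
    also have "\<dots> \<le> (?s' - ?s) * (?s' + ?s)"
    proof (rule mult_mono)
      show "norm (?y' + ?y) \<le> ?s' + ?s"
        using norm_triangle_ineq[of ?y' ?y] y' Suc by linarith
    qed (use Suc sqrt_bound_mono[of n] in auto)
    finally show ?thesis by simp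
  qed
  also have "\<dots> = sqrt_bound (Suc (Suc n)) - ?s'"
    unfolding sqrt_bound.simps(2)[of "Suc n"] by (subst (4) sqrt_bound.simps(2)) (simp add: field_simps del: sqrt_bound.simps)
  finally show ?case using y' by blast
qed

text \<open>When \<open>norm x = 1\<close> the increments need not decay geometrically; their norms
  are summable because the increments of the majorant telescope.\<close>

lemma sqrt_iter_convergent:
  assumes "norm x \<le> 1"
  shows "convergent (sqrt_iter x)"
proof -
  have "summable (\<lambda>n. sqrt_bound (Suc n) - sqrt_bound n)"
    using sqrt_bound_convergent telescope_summable unfolding convergent_def by blast
  then have "summable (\<lambda>n. norm (sqrt_iter x (Suc n) - sqrt_iter x n))"
    by (rule summable_comparison_test_ev[rotated])
       (use sqrt_iter_bounds[OF assms] in \<open>simp del: sqrt_iter.simps sqrt_bound.simps\<close>)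
  then have "summable (\<lambda>n. sqrt_iter x (Suc n) - sqrt_iter x n)"
    by (rule summable_norm_cancel)
  then have "convergent (\<lambda>n. \<Sum>i<n. sqrt_iter x (Suc i) - sqrt_iter x i)"
    by (simp only: summable_iff_convergent)
  then show ?thesis
    by (subst (asm) sum_lessThan_telescope) simp
qed

definition sqrt_compl :: "'a::unital_cstar_algebra \<Rightarrow> 'a"
  where "sqrt_compl x = 1 - lim (sqrt_iter x)"

text \<open>The bound on \<open>1 - sqrt_compl x\<close> is what certifies the root as positive in
  the sense of \<open>pos_elem\<close>, with \<open>t = 1\<close>.\<close>

lemma
  assumes "norm x \<le> 1"
  shows sqrt_compl_square: "sqrt_compl x * sqrt_compl x = 1 - x"
    and sqrt_compl_near_one: "norm (1 - sqrt_compl x) \<le> 1"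
    and sqrt_compl_adj: "adj x = x \<Longrightarrow> adj (sqrt_compl x) = sqrt_compl x"
    and sqrt_compl_intertwine:
      "norm x' \<le> 1 \<Longrightarrow> x * z = z * x' \<Longrightarrow> sqrt_compl x * z = z * sqrt_compl x'"
proof -
  define y where "y = lim (sqrt_iter x)"
  have lim: "sqrt_iter x \<longlonglongrightarrow> y"
    using sqrt_iter_convergent[OF assms] by (simp add: y_def convergent_LIMSEQ_iff)
  have "(\<lambda>n. sqrt_iter x (Suc n)) \<longlonglongrightarrow> (1/2) *\<^sub>R (x + y * y)"
    unfolding sqrt_iter.simps by (intro tendsto_intros lim)
  with LIMSEQ_Suc[OF lim] have "y = (1/2) *\<^sub>R (x + y * y)"
    by (rule LIMSEQ_unique)
  then have "2 *\<^sub>R y = 2 *\<^sub>R ((1/2) *\<^sub>R (x + y * y))" by (rule arg_cong)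
  then have "2 *\<^sub>R y = x + y * y" by simp
  then have "1 - (y + y) + y * y = 1 - x"
    by (simp add: scaleR_2)
  then show "sqrt_compl x * sqrt_compl x = 1 - x"
    by (simp add: sqrt_compl_def y_def[symmetric] algebra_simps)
  have "norm y \<le> 1"
    using sqrt_iter_bounds[OF assms] sqrt_bound_range
    by (intro LIMSEQ_le_const2[OF tendsto_norm[OF lim]]) (meson order_trans)
  then show "norm (1 - sqrt_compl x) \<le> 1"
    by (simp add: sqrt_compl_def y_def[symmetric])
  show "adj (sqrt_compl x) = sqrt_compl x" if "adj x = x"
  proof -
    have "(\<lambda>n. adj (sqrt_iter x n)) \<longlonglongrightarrow> adj y"
      by (rule bounded_linear.tendsto[OF bounded_linear_adj lim])
    then have "adj y = y"
      using lim by (simp add: sqrt_iter_adj[OF that] LIMSEQ_unique)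
    then show ?thesis by (simp add: sqrt_compl_def y_def[symmetric] adj_diff)
  qed
  show "sqrt_compl x * z = z * sqrt_compl x'" if x': "norm x' \<le> 1" and xz: "x * z = z * x'"
  proof -
    define y' where "y' = lim (sqrt_iter x')"
    have lim': "sqrt_iter x' \<longlonglongrightarrow> y'"
      using sqrt_iter_convergent[OF x'] by (simp add: y'_def convergent_LIMSEQ_iff)
    have "(\<lambda>n. sqrt_iter x n * z) \<longlonglongrightarrow> y * z" "(\<lambda>n. z * sqrt_iter x' n) \<longlonglongrightarrow> z * y'"
      by (intro tendsto_intros lim lim')+
    then have "y * z = z * y'"
      by (simp add: sqrt_iter_intertwine[OF xz] LIMSEQ_unique)
    then show ?thesis
      by (simp add: sqrt_compl_def y_def[symmetric] y'_def[symmetric] algebra_simps)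
  qed
qed

section \<open>The positive cone\<close>

text \<open>
  Membership in the positive cone is expressed by a norm inequality, which makes closure under
  sums evident and stands in for a statement about the spectrum.
\<close>

definition pos_elem :: "'a::unital_cstar_algebra \<Rightarrow> bool"
  where "pos_elem p \<longleftrightarrow> adj p = p \<and> (\<exists>t\<ge>0. norm (t *\<^sub>R 1 - p) \<le> t)"

lemma pos_elem_adj: "pos_elem p \<Longrightarrow> adj p = p"
  by (simp add: pos_elem_def)

lemma pos_elem_zero [simp]: "pos_elem 0"
  unfolding pos_elem_def by (auto intro: exI[of _ 0])

lemma pos_elem_add:
  assumes "pos_elem p" "pos_elem q"
  shows "pos_elem (p + q)"
proof -
  from assms obtain s t where "s \<ge> 0" "norm (s *\<^sub>R 1 - p) \<le> s" "t \<ge> 0" "norm (t *\<^sub>R 1 - q) \<le> t"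
    by (auto simp: pos_elem_def)
  then have "norm ((s + t) *\<^sub>R 1 - (p + q)) \<le> s + t"
    using norm_triangle_ineq[of "s *\<^sub>R 1 - p" "t *\<^sub>R 1 - q"]
    by (simp add: scaleR_add_left algebra_simps)
  with \<open>s \<ge> 0\<close> \<open>t \<ge> 0\<close> assms show ?thesis
    unfolding pos_elem_def by (auto simp: adj_add intro!: exI[of _ "s + t"])
qed

lemma pos_elem_sum: "(\<And>i. i \<in> I \<Longrightarrow> pos_elem (f i)) \<Longrightarrow> pos_elem (sum f I)"
  by (induction I rule: infinite_finite_induct) (simp_all add: pos_elem_add)

lemma pos_elem_scaleR:
  assumes "pos_elem p" "r \<ge> 0"
  shows "pos_elem (r *\<^sub>R p)"
proof -
  from assms obtain t where t: "t \<ge> 0" "norm (t *\<^sub>R 1 - p) \<le> t"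
    by (auto simp: pos_elem_def)
  have "norm ((r * t) *\<^sub>R 1 - r *\<^sub>R p) = r * norm (t *\<^sub>R 1 - p)"
    using assms(2) by (metis abs_of_nonneg norm_scaleR scaleR_diff_right scaleR_scaleR)
  with t assms show ?thesis
    unfolding pos_elem_def by (auto simp: adj_scaleR intro!: exI[of _ "r * t"] mult_left_mono)
qed

lemma pos_elem_bound_mono:
  fixes p :: "'a::unital_cstar_algebra"
  assumes "norm (t *\<^sub>R 1 - p) \<le> t" "t \<le> t'"
  shows "norm (t' *\<^sub>R 1 - p) \<le> t'"
proof -
  have "norm (t' *\<^sub>R 1 - p) = norm ((t' - t) *\<^sub>R 1 + (t *\<^sub>R 1 - p))"
    by (simp add: scaleR_diff_left)
  also have "\<dots> \<le> \<bar>t' - t\<bar> + t"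
    using norm_triangle_ineq norm_scaleR_one_le assms(1) by (meson add_mono order_trans)
  finally show ?thesis using assms(2) by simp
qed

text \<open>Both roots are taken with the same scale \<open>t\<close>, since rescaling by different
  factors would destroy the intertwining relation.\<close>

lemma pos_elem_root_pair:
  fixes w v :: "'a::unital_cstar_algebra"
  assumes "pos_elem w" "pos_elem v"
  obtains r q where "pos_elem r" "pos_elem q" "r * r = w" "q * q = v"
    "\<And>z. w * z = z * v \<Longrightarrow> r * z = z * q"
    "\<And>z. w * z = z * w \<Longrightarrow> r * z = z * r"
    "\<And>z. v * z = z * v \<Longrightarrow> q * z = z * q"
proof -
  from assms obtain s s' where s: "s \<ge> 0" "norm (s *\<^sub>R 1 - w) \<le> s" "s' \<ge> 0" "norm (s' *\<^sub>R 1 - v) \<le> s'"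
    by (auto simp: pos_elem_def)
  \<comment> \<open>The summand 1 makes \<open>t\<close> positive, so that division by
    \<open>t\<close> is possible even if both witnesses are 0.\<close>
  define t where "t = 1 + s + s'"
  have t: "t > 0" "norm (t *\<^sub>R 1 - w) \<le> t" "norm (t *\<^sub>R 1 - v) \<le> t"
    using s pos_elem_bound_mono[of s w t] pos_elem_bound_mono[of s' v t] by (auto simp: t_def)
  \<comment> \<open>\<open>1 - c p\<close> is \<open>p\<close> divided by \<open>t\<close>, so
    \<open>root p\<close> is \<open>sqrt t\<close> times a square root of that quotient.\<close>
  define c where "c p = 1 - (1/t) *\<^sub>R p" for p :: 'a
  define root where "root p = sqrt t *\<^sub>R sqrt_compl (c p)" for p :: 'a
  have c: "norm (c p) \<le> 1" if "norm (t *\<^sub>R 1 - p) \<le> t" for p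
  proof -
    have "c p = (1/t) *\<^sub>R (t *\<^sub>R 1 - p)"
      using t by (simp add: c_def scaleR_diff_right)
    then show ?thesis using that t by (simp add: divide_le_eq)
  qed
  have pos: "pos_elem (root p)" if "norm (t *\<^sub>R 1 - p) \<le> t" "adj p = p" for p
  proof -
    have "adj (c p) = c p"
      using that by (simp add: c_def adj_diff adj_scaleR)
    then have "pos_elem (sqrt_compl (c p))"
      unfolding pos_elem_def using sqrt_compl_adj sqrt_compl_near_one c that
      by (auto intro!: exI[of _ 1])
    then show ?thesis using t by (simp add: root_def pos_elem_scaleR)
  qed
  have sq: "root p * root p = p" if "norm (t *\<^sub>R 1 - p) \<le> t" for p
    using t sqrt_compl_square[OF c[OF that]] by (simp add: root_def) (simp add: c_def)
  have tw: "root p * z = z * root p'"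
    if "norm (t *\<^sub>R 1 - p) \<le> t" "norm (t *\<^sub>R 1 - p') \<le> t" "p * z = z * p'" for p p' z
  proof -
    have "c p * z = z * c p'" using that(3) by (simp add: c_def algebra_simps)
    then show ?thesis
      using sqrt_compl_intertwine[OF c[OF that(1)] c[OF that(2)]] by (simp add: root_def)
  qed
  show thesis
    by (rule that[of "root w" "root v"]) (use pos sq tw t assms pos_elem_adj in blast)+
qed

lemma pos_elem_root:
  assumes "pos_elem p"
  obtains r where "pos_elem r" "r * r = p" "\<And>z. p * z = z * p \<Longrightarrow> r * z = z * r"
  using pos_elem_root_pair[OF assms assms] by metis

text \<open>For commuting selfadjoint \<open>b\<close> and \<open>k\<close>, the element \<open>u = b + \<i> k\<close> satisfies
  \<open>adj u * u = b * b + k * k\<close>, and \<open>b\<close> is its real part.\<close>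

lemma norm_le_sum_squares:
  fixes b k :: "'a::unital_cstar_algebra"
  assumes b: "adj b = b" and k: "adj k = k" and comm: "b * k = k * b"
  shows "(norm b)\<^sup>2 \<le> norm (b * b + k * k)"
proof -
  define u where "u = b + \<i> *\<^sub>C k"
  have au: "adj u = b + (- \<i>) *\<^sub>C k"
    by (simp add: u_def adj_add adj_scaleC b k)
  have zero: "0 *\<^sub>C x = 0" for x :: 'a
    using scaleR_scaleC[of 0 x] by simp
  have cancel: "(- \<i>) *\<^sub>C x + \<i> *\<^sub>C x = 0" for x :: 'a
    using scaleC_add_left[of "- \<i>" \<i> x] by (simp add: zero)
  have one: "1 *\<^sub>C x = x" for x :: 'a
    using scaleR_scaleC[of 1 x] by simp
  have "adj u * u = b * b + k * k + ((- \<i>) *\<^sub>C (b * k) + \<i> *\<^sub>C (b * k))"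
    unfolding au unfolding u_def
    by (simp add: distrib_left distrib_right scaleC_mult_left scaleC_mult_right scaleC_scaleC scaleC_add_right one comm)
  then have u: "adj u * u = b * b + k * k" by (simp only: cancel add_0_right)
  have "adj u + u = b + b + ((- \<i>) *\<^sub>C k + \<i> *\<^sub>C k)"
    unfolding au unfolding u_def by simp
  then have "2 *\<^sub>R b = adj u + u" by (simp only: cancel add_0_right scaleR_2)
  then have "norm (2 *\<^sub>R b) \<le> norm (adj u) + norm u"
    by (metis norm_triangle_ineq)
  then have "norm b \<le> norm u" by simp
  then show ?thesis
    using cstar_identity[of u] u by (simp add: power_mono)
qed

text \<open>After scaling to norm 1, the root \<open>k\<close> of \<open>1 - b * b\<close> commutes
  with \<open>b\<close> and the two squares add up to 1, like sine and cosine;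
  \<open>norm_le_sum_squares\<close> then bounds \<open>k * k\<close>.\<close>

lemma selfadj_square_bound:
  assumes a: "adj a = a"
  shows "norm ((norm a)\<^sup>2 *\<^sub>R 1 - a * a) \<le> (norm a)\<^sup>2"
proof (cases "a = 0")
  case False
  define b where "b = (1 / norm a) *\<^sub>R a"
  have b: "adj b = b" "norm b = 1"
    using a False by (simp_all add: b_def adj_scaleR)
  define k where "k = sqrt_compl (b * b)"
  have bb: "norm (b * b) \<le> 1" using b selfadj_square_norm[of b] by simp
  have k: "adj k = k" "k * k = 1 - b * b" "k * b = b * k"
    using sqrt_compl_adj[OF bb] sqrt_compl_square[OF bb] sqrt_compl_intertwine[OF bb bb, of b]
    by (simp_all add: k_def adj_mult b mult.assoc)
  have "(norm k)\<^sup>2 \<le> norm (k * k + b * b)"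
    by (rule norm_le_sum_squares[OF k(1) b(1) k(3)])
  then have "norm (1 - b * b) \<le> 1"
    using selfadj_square_norm[OF k(1)] k norm_one_le by (smt (verit) diff_add_cancel)
  moreover have "(norm a)\<^sup>2 *\<^sub>R 1 - a * a = (norm a)\<^sup>2 *\<^sub>R (1 - b * b)"
    using False by (simp add: b_def scaleR_diff_right power2_eq_square)
  ultimately show ?thesis using mult_left_le[of "norm (1 - b * b)" "(norm a)\<^sup>2"] by simp
qed simp

lemma pos_elem_square: "adj a = a \<Longrightarrow> pos_elem (a * a)"
  unfolding pos_elem_def using selfadj_square_bound[of a]
  by (auto simp: adj_mult intro!: exI[of _ "(norm a)\<^sup>2"])

text \<open>The witness \<open>t\<close> can be taken to be \<open>norm p\<close> because
  \<open>p\<close> is a square. Without the existential, both conditions compare continuous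
  functions, which is what closedness of the cone rests on.\<close>

lemma pos_elem_iff_norm: "pos_elem p \<longleftrightarrow> adj p = p \<and> norm (norm p *\<^sub>R 1 - p) \<le> norm p"
proof
  assume p: "pos_elem p"
  then obtain r where "pos_elem r" "r * r = p" using pos_elem_root by blast
  then show "adj p = p \<and> norm (norm p *\<^sub>R 1 - p) \<le> norm p"
    using selfadj_square_bound[of r] selfadj_square_norm[of r] p by (auto simp: pos_elem_adj)
qed (auto simp: pos_elem_def intro: exI[of _ "norm p"])

lemma closed_pos_elem: "closed {p :: 'a::unital_cstar_algebra. pos_elem p}"
proof -
  have "closed {p :: 'a. adj p = p}"
    by (intro closed_Collect_eq continuous_intros
        linear_continuous_on bounded_linear_adj)
  moreover have "closed {p :: 'a. norm (norm p *\<^sub>R 1 - p) \<le> norm p}"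
    by (intro closed_Collect_le continuous_intros)
  ultimately show ?thesis
    unfolding pos_elem_iff_norm by (simp add: Collect_conj_eq closed_Int)
qed

text \<open>The roots of \<open>a\<close> and \<open>- a\<close> commute, since a root commutes with
  everything that commutes with its square; their squares add up to 0.\<close>

lemma pos_elem_antisym:
  assumes "pos_elem a" "pos_elem (- a)"
  shows "a = 0"
proof -
  obtain r where r: "pos_elem r" "r * r = a" "\<And>z. a * z = z * a \<Longrightarrow> r * z = z * r"
    using pos_elem_root[OF assms(1)] by blast
  obtain s where s: "pos_elem s" "s * s = - a"
    using pos_elem_root[OF assms(2)] by blast
  have "a = - (s * s)" using s(2) by simp
  then have "a * s = s * a" by (simp add: mult.assoc)
  then have "r * s = s * r" by (rule r(3))
  then have "(norm r)\<^sup>2 \<le> norm (r * r + s * s)"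
    by (rule norm_le_sum_squares[OF pos_elem_adj[OF r(1)] pos_elem_adj[OF s(1)]])
  then have "r = 0" using r(2) s(2) by simp
  then show ?thesis using r(2) by simp
qed

text \<open>It is the square of the selfadjoint \<open>m * p\<close> with \<open>m\<close> a root of
  \<open>q\<close>. The version for arbitrary \<open>p\<close> needs positivity of
  \<open>adj c * c\<close>, which rests on this one.\<close>

lemma pos_elem_commuting_sandwich:
  assumes "pos_elem q" "adj p = p" "q * p = p * q"
  shows "pos_elem (p * q * p)"
proof -
  obtain m where m: "pos_elem m" "m * m = q" "\<And>z. q * z = z * q \<Longrightarrow> m * z = z * m"
    using pos_elem_root[OF assms(1)] by blast
  have mp: "m * p = p * m" using m(3) assms(3) by blast
  then have "adj (m * p) = m * p"
    using assms(2) m(1) by (simp add: adj_mult pos_elem_adj)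
  then have "pos_elem ((m * p) * (m * p))" by (rule pos_elem_square)
  also have "(m * p) * (m * p) = p * q * p"
    using mp m(2) by (metis mult.assoc)
  finally show ?thesis .
qed

lemma pos_elem_sum_eq_0:
  assumes "pos_elem p" "pos_elem q" "p + q = 0"
  shows "p = 0"
proof -
  have "q = - p" using assms(3) by (simp add: add_eq_0_iff)
  then show ?thesis using assms(1,2) pos_elem_antisym by blast
qed

section \<open>Positivity of \<open>adj c * c\<close>\<close>

lemma selfadj_abs:
  assumes "adj h = h"
  obtains a where "pos_elem a" "a * a = h * h" "a * h = h * a"
proof -
  from pos_elem_square[OF assms] obtain a where
    a: "pos_elem a" "a * a = h * h" "\<And>z. h * h * z = z * (h * h) \<Longrightarrow> a * z = z * a"
    using pos_elem_root by blast
  then show thesis using that by (metis mult.assoc)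
qed

text \<open>
  The key step towards the positivity of \<open>adj c * c\<close>. The usual exchange of the spectra of \<open>adj x * x\<close> and
  \<open>x * adj x\<close> is replaced by intertwining their absolute values with \<open>x\<close>.
\<close>

lemma neg_pos_swap:
  assumes neg: "pos_elem (- (adj x * x))"
  shows "pos_elem (- (x * adj x))"
proof -
  define v where "v = adj x * x"
  define w where "w = x * adj x"
  have sa: "adj v = v" "adj w = w" by (simp_all add: v_def w_def adj_mult adj_adj)
  \<comment> \<open>\<open>r\<close> and \<open>q\<close> are the absolute values of
    \<open>w\<close> and \<open>v\<close>; \<open>w * x = x * v\<close> lets \<open>x\<close> carry
    one into the other.\<close>
  obtain r q where rq: "pos_elem r" "pos_elem q" "r * r = w * w" "q * q = v * v"
    "\<And>z. (w * w) * z = z * (v * v) \<Longrightarrow> r * z = z * q"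
    "\<And>z. (w * w) * z = z * (w * w) \<Longrightarrow> r * z = z * r"
    "\<And>z. (v * v) * z = z * (v * v) \<Longrightarrow> q * z = z * q"
    by (fact pos_elem_root_pair[OF pos_elem_square[OF sa(2)] pos_elem_square[OF sa(1)]])
  have rx: "r * x = x * q" by (rule rq(5)) (simp add: v_def w_def mult.assoc)
  have rw: "r * w = w * r" by (rule rq(6)) (simp add: mult.assoc)
  have qv: "q * v = v * q" by (rule rq(7)) (simp add: mult.assoc)
  \<comment> \<open>Twice the positive part of \<open>v\<close>. It has to vanish because
    \<open>- v\<close> is positive.\<close>
  define p where "p = q + v"
  have p: "adj p = p" "q * p = p * q" "v * p = p * v"
    by (simp_all add: p_def adj_add pos_elem_adj[OF rq(2)] sa(1) distrib_left distrib_right qv)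
  have "p * q * p + p * (- v) * p = p * ((q - v) * p)"
    by (simp add: algebra_simps)
  also have "(q - v) * p = 0"
    by (simp add: p_def distrib_left left_diff_distrib qv rq(4))
  finally have "p * q * p + p * (- v) * p = 0" by simp
  moreover have "pos_elem (p * q * p)"
    using rq(2) p by (intro pos_elem_commuting_sandwich) auto
  moreover have "pos_elem (p * (- v) * p)"
    using neg p by (intro pos_elem_commuting_sandwich) (auto simp: v_def)
  ultimately have pqp: "p * q * p = 0" and pvp: "p * (- v) * p = 0"
    using pos_elem_sum_eq_0 by (metis add.commute)+
  \<comment> \<open>The cube of \<open>p\<close> is a difference of two vanishing terms;
    selfadjointness then brings the fourth power down to \<open>p\<close>.\<close>
  have "(p * p) * p = p * q * p - p * (- v) * p"
    by (simp add: p_def algebra_simps)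
  then have "(p * p) * (p * p) = 0"
    using pqp pvp by (simp add: mult.assoc[symmetric])
  then have "p = 0"
    using p(1) selfadj_square_eq_0[of "p * p"] selfadj_square_eq_0[of p] by (simp add: adj_mult)
  then have "(r + w) * x = 0"
    using rx by (simp add: p_def w_def v_def distrib_right mult.assoc flip: distrib_left)
  then have "(r + w) * w = 0"
    by (simp add: w_def flip: mult.assoc)
  then have "r * w + w * w = 0" by (simp add: distrib_right)
  \<comment> \<open>By \<open>r * r = w * w\<close> this square is twice
    \<open>r * w + w * w\<close>.\<close>
  then have "(r + w) * (r + w) = 0"
    using rw rq(3) by (simp add: algebra_simps)
  moreover have "adj (r + w) = r + w" using rq(1) sa by (simp add: adj_add pos_elem_adj)
  ultimately have "r = - w" by (simp add: selfadj_square_eq_0 eq_neg_iff_add_eq_0)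
  then show ?thesis using rq(1) by (simp add: w_def)
qed

text \<open>\<open>a\<close> and \<open>b\<close> are, up to sign, twice the real and imaginary
  parts of \<open>x\<close>; the sum of their squares is twice the element in question.\<close>

lemma pos_elem_adj_mult_add:
  fixes x :: "'a::unital_cstar_algebra"
  shows "pos_elem (adj x * x + x * adj x)"
proof -
  define a where "a = x + adj x"
  define b where "b = \<i> *\<^sub>C (x - adj x)"
  have mc: "(- \<i>) *\<^sub>C z = - (\<i> *\<^sub>C z)" and m1: "(-1) *\<^sub>C z = - z" for z :: 'a
  proof -
    show "(-1) *\<^sub>C z = - z" using scaleR_scaleC[of "-1" z] by simp
    then show "(- \<i>) *\<^sub>C z = - (\<i> *\<^sub>C z)"
      using scaleC_scaleC[of \<i> "-1" z] scaleR_scaleC[of "-1"] scaleC_scaleC[of "-1" \<i> z]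
      by (metis mult_minus1 scaleR_minus1_left of_real_1 of_real_minus)
  qed
  have cm: "\<i> *\<^sub>C (- z) = - (\<i> *\<^sub>C z)" for z :: 'a
    using scaleC_add_right[of \<i> z "- z"] scaleC_add_right[of \<i> 0 "0::'a"]
    by (simp add: eq_neg_iff_add_eq_0 add.commute)
  have "adj a = a" by (simp add: a_def adj_add adj_adj add.commute)
  moreover have "adj b = b"
    using cm[of "x - adj x"] by (simp add: b_def adj_scaleC adj_diff adj_adj mc)
  ultimately have "pos_elem (a * a + b * b)" by (intro pos_elem_add pos_elem_square)
  moreover have "b * b = - ((x - adj x) * (x - adj x))"
    by (simp add: b_def scaleC_mult_left scaleC_mult_right scaleC_scaleC m1)
  then have "a * a + b * b = 2 *\<^sub>R (adj x * x + x * adj x)"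
    by (simp add: a_def scaleR_2 algebra_simps)
  ultimately have "pos_elem ((1/2) *\<^sub>R (2 *\<^sub>R (adj x * x + x * adj x)))"
    by (metis pos_elem_scaleR zero_le_divide_1_iff zero_le_numeral)
  then show ?thesis by simp
qed

text \<open>\<open>f\<close> is twice the negative part of \<open>h\<close>, and
  \<open>x = c * f\<close> has \<open>adj x * x = - (f * a * f)\<close>, a negative element. By the
  swap \<open>x * adj x\<close> is negative too, while the sum of the two is positive; hence
  \<open>adj x * x\<close> is both positive and negative, \<open>x = 0\<close>, and \<open>f\<close>
  vanishes.\<close>

lemma pos_elem_adj_mult: "pos_elem (adj c * c)"
proof -
  define h where "h = adj c * c"
  have h: "adj h = h" by (simp add: h_def adj_mult adj_adj)
  obtain a where a: "pos_elem a" "a * a = h * h" "a * h = h * a"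
    using selfadj_abs[OF h] by metis
  define f where "f = a - h"
  have f: "adj f = f" "a * f = f * a"
    using h a by (simp_all add: f_def adj_diff pos_elem_adj algebra_simps)
  have hf: "h * f = - (a * f)" using a by (simp add: f_def algebra_simps)
  define x where "x = c * f"
  have "adj x * x = f * (h * f)"
    using f by (simp add: x_def h_def adj_mult mult.assoc)
  then have "- (adj x * x) = f * a * f" by (simp add: hf mult.assoc)
  moreover have "pos_elem (f * a * f)"
    using f a by (intro pos_elem_commuting_sandwich)
  ultimately have n: "pos_elem (- (adj x * x))" by simp
  have "adj x * x = (adj x * x + x * adj x) + - (x * adj x)" by simp
  then have "pos_elem (adj x * x)"
    using pos_elem_add[OF pos_elem_adj_mult_add neg_pos_swap[OF n]] by metis
  with n have "x = 0" using pos_elem_antisym adj_mult_self_eq_0 by blast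
  then have "h * f = 0" by (simp add: h_def x_def mult.assoc)
  with hf have "f * f = 0" by (subst f_def) (simp add: left_diff_distrib)
  with f have "f = 0" by (simp add: selfadj_square_eq_0)
  then show ?thesis using a by (simp add: f_def h_def)
qed

lemma cstar_pos_iff: "cstar_pos p \<longleftrightarrow> pos_elem p"
  unfolding cstar_pos_def by (metis pos_elem_adj pos_elem_adj_mult pos_elem_root)

section \<open>From order bounds to norm bounds\<close>

text \<open>\<open>adj b * b\<close> and its difference from \<open>s\<close> are squares of
  commuting selfadjoint elements. The absolute value is there because in the zero algebra
  \<open>s\<close> may be negative.\<close>

lemma norm_le_of_pos_elem_diff:
  fixes b :: "'a::unital_cstar_algebra"
  assumes "pos_elem (s *\<^sub>R 1 - adj b * b)"
  shows "(norm b)\<^sup>2 \<le> \<bar>s\<bar>"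
proof -
  obtain k where k: "pos_elem k" "k * k = s *\<^sub>R 1 - adj b * b"
    using pos_elem_root[OF assms] by blast
  obtain d where d: "pos_elem d" "d * d = adj b * b"
    "\<And>z. adj b * b * z = z * (adj b * b) \<Longrightarrow> d * z = z * d"
    using pos_elem_root[OF pos_elem_adj_mult[of b]] by blast
  have "adj b * b = s *\<^sub>R 1 - k * k" using k by simp
  then have "adj b * b * k = k * (adj b * b)" by 
    (simp only: left_diff_distrib right_diff_distrib mult_scaleR_left mult_scaleR_right
      mult_1_left mult_1_right mult.assoc)
  then have "d * k = k * d" by (rule d(3))
  then have "(norm d)\<^sup>2 \<le> norm (d * d + k * k)"
    by (rule norm_le_sum_squares[OF pos_elem_adj[OF d(1)] pos_elem_adj[OF k(1)]])
  also have "d * d + k * k = s *\<^sub>R 1" by (simp add: d(2) k(2))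
  also have "norm (s *\<^sub>R 1 :: 'a) \<le> \<bar>s\<bar>" by (rule norm_scaleR_one_le)
  finally show ?thesis
    using selfadj_square_norm[OF pos_elem_adj[OF d(1)]] cstar_identity[of b] by (simp add: d(2))
qed

text \<open>
  The element \<open>c\<close> is twice the positive part of \<open>adj b * b - s\<close>. Testing the assumption on
  \<open>x = c\<close> forces \<open>c = 0\<close>.
\<close>

lemma norm_le_of_faithful:
  fixes E :: "'b::unital_cstar_algebra \<Rightarrow> 'a::unital_cstar_algebra"
  assumes lin: "clinear_map E" and pos: "\<And>x. cstar_pos x \<Longrightarrow> cstar_pos (E x)"
    and faithful: "faithful_map E"
    and bound: "\<And>x. pos_elem (s *\<^sub>R E (adj x * x) - E (adj (b * x) * (b * x)))"
  shows "(norm b)\<^sup>2 \<le> \<bar>s\<bar>"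
proof -
  define h where "h = adj b * b - s *\<^sub>R 1"
  have h: "adj h = h" by (simp add: h_def adj_mult adj_diff adj_scaleR adj_adj)
  obtain a where a: "pos_elem a" "a * a = h * h" "a * h = h * a"
    using selfadj_abs[OF h] by metis
  define c where "c = a + h"
  have c: "adj c = c" "a * c = c * a" "h * c = a * c"
    using h a by (simp_all add: c_def adj_add pos_elem_adj algebra_simps)
  \<comment> \<open>A root of \<open>a\<close> turns \<open>c * h * c = c * a * c\<close> into
    \<open>adj z * z\<close> with \<open>z = k * c\<close>, to which positivity and faithfulness of
    \<open>E\<close> apply.\<close>
  obtain k where k: "pos_elem k" "k * k = a" using pos_elem_root[OF a(1)] by blast
  have add: "E (x + y) = E x + E y" for x y using lin by (simp add: clinear_map_def)
  have diff: "E (x - y) = E x - E y" for x y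
    using add[of "x - y" y] by (simp add: eq_diff_eq)
  have scale: "E (r *\<^sub>R x) = r *\<^sub>R E x" for r x
    using lin by (simp add: clinear_map_def scaleR_scaleC)
  have "adj (k * c) * (k * c) = c * (h * c)"
    using k c by (simp add: adj_mult pos_elem_adj mult.assoc) (metis mult.assoc)
  also have "\<dots> = adj (b * c) * (b * c) - s *\<^sub>R (adj c * c)"
    by (simp add: h_def algebra_simps adj_mult c(1))
  finally have "E (adj (k * c) * (k * c)) = - (s *\<^sub>R E (adj c * c) - E (adj (b * c) * (b * c)))"
    by (simp add: diff scale)
  then have "pos_elem (- E (adj (k * c) * (k * c)))" using bound by simp
  moreover have "pos_elem (E (adj (k * c) * (k * c)))"
    using pos pos_elem_adj_mult[of "k * c"] unfolding cstar_pos_iff by blast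
  ultimately have "k * c = 0"
    using faithful pos_elem_antisym unfolding faithful_map_def by blast
  then have "a * c = 0" using k(2) by (simp add: mult.assoc flip: k(2))
  then have "c * c = 0" using c(3) by (subst c_def) (simp add: distrib_right)
  then have "c = 0" using c(1) by (simp add: selfadj_square_eq_0)
  then have "a = - h" by (simp add: c_def eq_neg_iff_add_eq_0)
  then have "pos_elem (s *\<^sub>R 1 - adj b * b)" using a(1) by (simp add: h_def)
  then show ?thesis by (rule norm_le_of_pos_elem_diff)
qed

section \<open>Means of unitary conjugates\<close>

definition pos_le :: "'a::unital_cstar_algebra \<Rightarrow> 'a \<Rightarrow> bool"  (infix "\<preceq>" 50)
  where "a \<preceq> b \<longleftrightarrow> pos_elem (b - a)"

lemma pos_le_trans [trans]: "a \<preceq> b \<Longrightarrow> b \<preceq> c \<Longrightarrow> a \<preceq> c"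
  unfolding pos_le_def using pos_elem_add[of "b - a" "c - b"] by simp

lemma pos_le_add_mono: "a \<preceq> b \<Longrightarrow> c \<preceq> d \<Longrightarrow> a + c \<preceq> b + d"
  unfolding pos_le_def using pos_elem_add[of "b - a" "d - c"] by (simp add: algebra_simps)

lemma pos_le_sum_mono: "(\<And>i. i \<in> I \<Longrightarrow> f i \<preceq> g i) \<Longrightarrow> sum f I \<preceq> sum g I"
  unfolding pos_le_def using pos_elem_sum[of I "\<lambda>i. g i - f i"] by (simp add: sum_subtractf)

lemma pos_le_scaleR_mono: "a \<preceq> b \<Longrightarrow> r \<ge> 0 \<Longrightarrow> r *\<^sub>R a \<preceq> r *\<^sub>R b"
  unfolding pos_le_def using pos_elem_scaleR[of "b - a" r] by (simp add: scaleR_diff_right)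

lemma pos_le_add_right: "pos_elem b \<Longrightarrow> a \<preceq> a + b"
  by (simp add: pos_le_def)

definition conj_hull :: "'b::unital_cstar_algebra \<Rightarrow> 'b set"
  where "conj_hull y = convex hull {v * y * adj v | v. v \<in> unitaries}"

lemma unitaries_mult: "u \<in> unitaries \<Longrightarrow> v \<in> unitaries \<Longrightarrow> u * v \<in> unitaries"
  unfolding unitaries_def by (simp add: adj_mult) (metis mult.assoc mult_1_left)

lemma norm_unitary_le:
  fixes u :: "'a::unital_cstar_algebra"
  shows "u \<in> unitaries \<Longrightarrow> norm u \<le> 1"
proof -
  assume "u \<in> unitaries"
  then have "(norm u)\<^sup>2 \<le> 1"
    using cstar_identity[of u] norm_one_le[where 'a = 'a] by (simp add: unitaries_def)
  then show ?thesis by (simp add: abs_square_le_1)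
qed

lemma norm_unitary_conj_le:
  assumes "u \<in> unitaries"
  shows "norm (u * x * adj u) \<le> norm x"
proof -
  have "norm (u * x * adj u) \<le> norm u * norm x * norm (adj u)"
    by (meson norm_mult_ineq mult_right_mono norm_ge_zero order_trans)
  also have "\<dots> \<le> 1 * norm x * 1"
    using norm_unitary_le[OF assms] by (intro mult_mono) auto
  finally show ?thesis by simp
qed

lemma norm_conj_hull_le: "z \<in> conj_hull y \<Longrightarrow> norm z \<le> norm y"
proof -
  have "conj_hull y \<subseteq> cball 0 (norm y)"
    unfolding conj_hull_def by (rule hull_minimal) (auto simp: norm_unitary_conj_le)
  then show "z \<in> conj_hull y \<Longrightarrow> norm z \<le> norm y" by auto
qed

lemma self_in_conj_hull: "y \<in> conj_hull y"
proof -
  have "1 * y * adj 1 \<in> {v * y * adj v | v. v \<in> unitaries}"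
    by (auto simp: unitaries_def intro!: exI[of _ 1])
  from hull_inc[OF this, of convex] show ?thesis by (simp add: conj_hull_def)
qed

lemma conj_hull_conj:
  assumes u: "u \<in> unitaries" and z: "z \<in> conj_hull y"
  shows "u * z * adj u \<in> conj_hull y"
proof -
  let ?S = "{v * y * adj v | v. v \<in> unitaries}"
  have lin: "linear (\<lambda>z. u * z * adj u)"
    by (rule linearI) (simp_all add: algebra_simps)
  have "u * z * adj u \<in> (\<lambda>z. u * z * adj u) ` (convex hull ?S)"
    using z by (simp add: conj_hull_def)
  also have "\<dots> = convex hull ((\<lambda>z. u * z * adj u) ` ?S)"
    by (rule convex_hull_linear_image[OF lin])
  also have "\<dots> \<subseteq> convex hull ?S"
  proof (rule hull_mono, clarify)
    fix v :: 'a assume "v \<in> unitaries"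
    then show "\<exists>w. u * (v * y * adj v) * adj u = w * y * adj w \<and> w \<in> unitaries"
      using u by (intro exI[of _ "u * v"]) (simp add: unitaries_mult adj_mult mult.assoc)
  qed
  finally show ?thesis by (simp add: conj_hull_def)
qed

section \<open>The inner product defined by the expectation\<close>

lemma ex_large_count:
  fixes R \<delta> c :: real
  assumes "\<delta> > 0" "R \<ge> 0" "c \<ge> 0"
  shows "\<exists>N\<ge>1. 2 * R * sqrt (c / real N) \<le> \<delta>"
proof -
  have "(\<lambda>N. 2 * R * sqrt (c / real N)) \<longlonglongrightarrow> 2 * R * sqrt 0"
    by (intro tendsto_intros real_tendsto_divide_at_top filterlim_real_sequentially)
  then have "\<forall>\<^sub>F N in sequentially. 2 * R * sqrt (c / real N) < \<delta>"
    using assms(1) by (intro order_tendstoD(2)) auto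
  then have "\<forall>\<^sub>F N in sequentially. 2 * R * sqrt (c / real N) < \<delta> \<and> N \<ge> 1"
    using eventually_ge_at_top by (rule eventually_conj)
  from eventually_happens'[OF sequentially_bot this] show ?thesis by (auto intro: less_imp_le)
qed

context reduced_crossed_product
begin

section \<open>Rules for the coefficients and the group unitaries\<close>

lemma iota_add: "\<iota> (a + b) = \<iota> a + \<iota> b"
  and iota_scaleC: "\<iota> (c *\<^sub>C a) = c *\<^sub>C \<iota> a"
  and iota_mult: "\<iota> (a * b) = \<iota> a * \<iota> b"
  and iota_adj: "\<iota> (adj a) = adj (\<iota> a)"
  and iota_one: "\<iota> 1 = 1"
  using iota_hom by (simp_all add: unital_star_hom_def clinear_map_def)

lemma E_add: "E (x + y) = E x + E y"
  and E_scaleC: "E (c *\<^sub>C x) = c *\<^sub>C E x"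
  and E_iota: "E (\<iota> a) = a"
  and E_bimodule: "E (\<iota> a * x * \<iota> b) = a * E x * b"
  and E_pos: "cstar_pos x \<Longrightarrow> cstar_pos (E x)"
  and E_norm: "norm (E x) \<le> norm x"
  using E_expectation by (simp_all add: conditional_expectation_def clinear_map_def)

lemma iota_scaleR: "\<iota> (r *\<^sub>R a) = r *\<^sub>R \<iota> a"
  by (simp add: scaleR_scaleC iota_scaleC)

text \<open>The root \<open>k\<close> of \<open>(norm a)\<^sup>2 *\<^sub>R 1 - adj a * a\<close> is
  carried along by \<open>\<iota>\<close>, so the same order bound holds for the image and yields
  the norm bound.\<close>

lemma norm_iota_le: "norm (\<iota> a) \<le> norm a"
proof -
  have "pos_elem ((norm a)\<^sup>2 *\<^sub>R 1 - adj a * a)"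
    unfolding pos_elem_def
    by (auto simp: adj_diff adj_scaleR adj_mult adj_adj cstar_identity intro!: exI[of _ "(norm a)\<^sup>2"])
  then obtain k where k: "pos_elem k" "k * k = (norm a)\<^sup>2 *\<^sub>R 1 - adj a * a"
    using pos_elem_root by blast
  then have "(norm a)\<^sup>2 *\<^sub>R 1 = adj k * k + adj a * a" by (simp add: pos_elem_adj)
  then have "\<iota> ((norm a)\<^sup>2 *\<^sub>R 1) = \<iota> (adj k * k + adj a * a)" by (rule arg_cong)
  then have "(norm a)\<^sup>2 *\<^sub>R 1 - adj (\<iota> a) * \<iota> a = adj (\<iota> k) * \<iota> k"
    by (simp add: iota_scaleR iota_one iota_add iota_mult iota_adj)
  then have "(norm (\<iota> a))\<^sup>2 \<le> \<bar>(norm a)\<^sup>2\<bar>"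
    by (intro norm_le_of_pos_elem_diff) (simp add: pos_elem_adj_mult)
  also have "\<dots> = (norm a)\<^sup>2" by (rule abs_power2)
  finally show ?thesis by (rule power2_le_imp_le) (rule norm_ge_zero)
qed

lemma E_scaleR: "E (r *\<^sub>R x) = r *\<^sub>R E x"
  by (simp add: scaleR_scaleC E_scaleC)

lemma E_bounded_linear: "bounded_linear E"
  by (rule bounded_linear_intro[where K = 1]) (simp_all add: E_add E_scaleR E_norm)

lemmas E_diff = linear_diff[OF bounded_linear.linear[OF E_bounded_linear]]
lemmas E_sum = linear_sum[OF bounded_linear.linear[OF E_bounded_linear]]

lemma lam_adj_lam: "g \<in> carrier G \<Longrightarrow> adj (lam g) * lam g = 1"
  using lam_unitary by (auto simp: unitaries_def)

lemma lam_one: "lam \<one> = 1"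
proof -
  have "lam \<one> * lam \<one> = lam \<one>"
    using lam_lam[of \<one> \<one>] by (simp add: sigma_one_right iota_one)
  then show ?thesis
    using lam_adj_lam[of \<one>] by (metis mult.assoc mult_1_left one_closed)
qed

text \<open>The new coefficient is the preimage of \<open>a\<close> under \<open>\<alpha> g\<close>.
  It stays anonymous, as do those in the next two lemmas: only the group element in front matters
  for supports.\<close>

lemma iota_lam:
  assumes g: "g \<in> carrier G"
  obtains a' where "\<iota> a * lam g = lam g * \<iota> a'"
proof -
  obtain a' where "\<alpha> g a' = a"
    using alpha_aut[OF g] by (metis bij_is_surj star_automorphism_def surjD)
  then have "\<iota> a * lam g = lam g * \<iota> a' * (adj (lam g) * lam g)"
    using lam_covariant[OF g, of a'] by (simp add: mult.assoc)
  then show thesis using that by (simp add: lam_adj_lam g)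
qed

lemma lam_mult:
  assumes g: "g \<in> carrier G" "h \<in> carrier G"
  obtains s where "lam g * lam h = lam (g \<otimes> h) * \<iota> s"
  using iota_lam[of "g \<otimes> h" "\<sigma> g h"] lam_lam[of g h] assms by auto

lemma adj_lam:
  assumes g: "g \<in> carrier G"
  obtains s where "adj (lam g) = lam (inv g) * \<iota> s"
proof -
  let ?s = "\<sigma> g (inv g)"
  have "adj (lam g) * (lam g * lam (inv g)) = adj (lam g) * \<iota> ?s"
    using lam_lam[of g "inv g"] g by (simp add: lam_one)
  then have "lam (inv g) = adj (lam g) * \<iota> ?s"
    using lam_adj_lam[OF g] by (simp add: mult.assoc[symmetric])
  then have "lam (inv g) * \<iota> (adj ?s) = adj (lam g) * \<iota> (?s * adj ?s)"
    by (simp add: iota_mult mult.assoc)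
  also have "?s * adj ?s = 1" using sigma_unitary[of g "inv g"] g by (simp add: unitaries_def)
  finally show thesis using that by (metis iota_one mult_1_right)
qed

section \<open>Finitely supported elements\<close>

text \<open>The span is algebraic, so each member involves finitely many group elements and splits
  exactly along any partition of the support. Real scalars suffice, as \<open>a\<close> ranges over
  a complex algebra.\<close>

definition supp_span :: "'g set \<Rightarrow> 'b set"
  where "supp_span T = span {lam g * \<iota> a | g a. g \<in> T}"

lemma subspace_supp_span: "subspace (supp_span T)"
  by (simp add: supp_span_def)

lemmas supp_span_add = subspace_add[OF subspace_supp_span]
lemmas supp_span_diff = subspace_diff[OF subspace_supp_span]
lemmas supp_span_scale = subspace_scale[OF subspace_supp_span]
lemmas supp_span_sum = subspace_sum[OF subspace_supp_span]
lemmas supp_span_zero = subspace_0[OF subspace_supp_span]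

lemma supp_span_gen: "g \<in> T \<Longrightarrow> lam g * \<iota> a \<in> supp_span T"
  unfolding supp_span_def by (rule span_base) auto

lemma supp_span_mono: "S \<subseteq> T \<Longrightarrow> x \<in> supp_span S \<Longrightarrow> x \<in> supp_span T"
  unfolding supp_span_def using span_mono[of "{lam g * \<iota> a | g a. g \<in> S}" "{lam g * \<iota> a | g a. g \<in> T}"] by blast

lemma supp_span_linear_image:
  assumes "linear f" "\<And>g a. g \<in> T \<Longrightarrow> f (lam g * \<iota> a) \<in> W" "subspace W" "x \<in> supp_span T"
  shows "f x \<in> W"
  using assms(4) unfolding supp_span_def
proof (induction rule: span_induct)
  case base
  show ?case using linear_subspace_vimage[OF assms(1,3)] by (simp add: vimage_def)
next
  case (step x)
  then show ?case using assms(2) by auto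
qed

lemma supp_span_mult:
  assumes x: "x \<in> supp_span S" and y: "y \<in> supp_span T"
    and ST: "S \<subseteq> carrier G" "T \<subseteq> carrier G"
    and R: "\<And>s t. s \<in> S \<Longrightarrow> t \<in> T \<Longrightarrow> s \<otimes> t \<in> R"
  shows "x * y \<in> supp_span R"
proof -
  have gen: "(lam s * \<iota> a) * (lam t * \<iota> b) \<in> supp_span R" if st: "s \<in> S" "t \<in> T" for s t a b
  proof -
    have c: "s \<in> carrier G" "t \<in> carrier G" using st ST by auto
    obtain a' where a': "\<iota> a * lam t = lam t * \<iota> a'" using iota_lam[OF c(2)] by blast
    obtain s' where s': "lam s * lam t = lam (s \<otimes> t) * \<iota> s'" using lam_mult[OF c] by blast
    have "(lam s * \<iota> a) * (lam t * \<iota> b) = lam s * (\<iota> a * lam t) * \<iota> b" by (simp add: mult.assoc)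
    also have "\<dots> = (lam s * lam t) * \<iota> a' * \<iota> b" by (simp add: a' mult.assoc)
    also have "\<dots> = lam (s \<otimes> t) * \<iota> (s' * a' * b)" by (simp add: s' mult.assoc iota_mult)
    finally show ?thesis using R[OF st] by (simp add: supp_span_gen)
  qed
  have "(lam s * \<iota> a) * y \<in> supp_span R" if "s \<in> S" for s a
    by (rule supp_span_linear_image[where f = "\<lambda>y. (lam s * \<iota> a) * y", OF _ gen[OF that] subspace_supp_span y])
       (auto intro!: linearI simp: distrib_left)
  then show ?thesis
    by (intro supp_span_linear_image[where f = "\<lambda>x. x * y", OF _ _ subspace_supp_span x])
       (auto intro!: linearI simp: distrib_right)
qed

lemma supp_span_adj:
  assumes x: "x \<in> supp_span S" and S: "S \<subseteq> carrier G" and R: "\<And>s. s \<in> S \<Longrightarrow> inv s \<in> R"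
  shows "adj x \<in> supp_span R"
proof (rule supp_span_linear_image[OF _ _ subspace_supp_span x])
  show "linear (adj :: 'b \<Rightarrow> 'b)" by (rule bounded_linear.linear[OF bounded_linear_adj])
  fix s a assume s: "s \<in> S"
  then have c: "s \<in> carrier G" "inv s \<in> carrier G" using S by auto
  obtain t where t: "adj (lam s) = lam (inv s) * \<iota> t" using adj_lam[OF c(1)] by blast
  obtain a' where a': "\<iota> (adj a) * lam (inv s) = lam (inv s) * \<iota> a'"
    using iota_lam[OF c(2)] by blast
  have "adj (lam s * \<iota> a) = \<iota> (adj a) * lam (inv s) * \<iota> t"
    by (simp add: adj_mult t iota_adj mult.assoc)
  also have "\<dots> = lam (inv s) * \<iota> (a' * t)" by (simp add: a' mult.assoc iota_mult)
  finally show "adj (lam s * \<iota> a) \<in> supp_span R" using R[OF s] by (simp add: supp_span_gen)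
qed

lemma E_supp_span:
  assumes "x \<in> supp_span T" "T \<subseteq> carrier G - {\<one>}"
  shows "E x = 0"
proof -
  have "E x \<in> {0}"
  proof (rule supp_span_linear_image[OF _ _ _ assms(1)])
    show "linear E" by (rule bounded_linear.linear[OF E_bounded_linear])
    fix g a assume "g \<in> T"
    then have "E (lam g) = 0" using assms(2) by (intro E_lam) auto
    then show "E (lam g * \<iota> a) \<in> {0}"
      using E_bimodule[of 1 "lam g" a] by (simp add: iota_one)
  qed simp
  then show ?thesis by simp
qed

text \<open>For distinct \<open>s\<close> and \<open>t\<close> the product
  \<open>inv s \<otimes> t\<close> is never the identity, so \<open>E\<close> annihilates every
  term.\<close>

lemma supp_span_orth:
  assumes "x \<in> supp_span S" "y \<in> supp_span T" "S \<subseteq> carrier G" "T \<subseteq> carrier G" "S \<inter> T = {}"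
  shows "E (adj x * y) = 0"
proof (rule E_supp_span)
  have "adj x \<in> supp_span {inv s | s. s \<in> S}"
    by (rule supp_span_adj[OF assms(1,3)]) auto
  then show "adj x * y \<in> supp_span (carrier G - {\<one>})"
  proof (rule supp_span_mult)
    fix s' t assume "s' \<in> {inv s | s. s \<in> S}" and t: "t \<in> T"
    then obtain s where s: "s' = inv s" "s \<in> S" by blast
    with t assms have "s \<in> carrier G" "t \<in> carrier G" "s \<noteq> t" by auto
    then show "s' \<otimes> t \<in> carrier G - {\<one>}"
      using s(1) by (auto simp: inv_solve_left')
  qed (use assms in auto)
qed simp

lemma supp_span_Un:
  assumes "x \<in> supp_span (S \<union> T)"
  obtains u v where "u \<in> supp_span S" "v \<in> supp_span T" "x = u + v"
proof -
  have "{lam g * \<iota> a | g a. g \<in> S \<union> T} = {lam g * \<iota> a | g a. g \<in> S} \<union> {lam g * \<iota> a | g a. g \<in> T}"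
    by blast
  with assms that show thesis
    by (auto simp: supp_span_def span_Un)
qed

lemma supp_span_empty: "supp_span {} = {0}"
  by (simp add: supp_span_def)

lemma supp_span_UN:
  assumes "finite K" "x \<in> supp_span (\<Union>k\<in>K. T k)"
  shows "\<exists>v. (\<forall>k\<in>K. v k \<in> supp_span (T k)) \<and> x = sum v K"
  using assms
proof (induction K arbitrary: x)
  case empty
  then show ?case by (simp add: supp_span_empty)
next
  case (insert k K)
  then obtain u w where uw: "u \<in> supp_span (T k)" "w \<in> supp_span (\<Union>k\<in>K. T k)" "x = u + w"
    using supp_span_Un[of x "T k" "\<Union>k\<in>K. T k"] by (metis UN_insert)
  then obtain v where v: "\<forall>k\<in>K. v k \<in> supp_span (T k)" "w = sum v K"
    using insert.IH by blast
  have "sum (v(k := u)) K = sum v K"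
    using insert.hyps by (intro sum.cong) auto
  with uw v insert.hyps show ?case
    by (intro exI[of _ "v(k := u)"]) auto
qed

lemma supp_span_split:
  assumes "finite K" "x \<in> supp_span (carrier G)"
  shows "\<exists>v r. (\<forall>k\<in>K. v k \<in> supp_span (T k)) \<and>
    r \<in> supp_span (carrier G - (\<Union>k\<in>K. T k)) \<and> x = sum v K + r"
proof -
  have "x \<in> supp_span ((\<Union>k\<in>K. T k) \<union> (carrier G - (\<Union>k\<in>K. T k)))"
    by (rule supp_span_mono[OF _ assms(2)]) auto
  then obtain u r where "u \<in> supp_span (\<Union>k\<in>K. T k)"
    "r \<in> supp_span (carrier G - (\<Union>k\<in>K. T k))" "x = u + r"
    using supp_span_Un by blast
  with supp_span_UN[OF assms(1)] show ?thesis by blast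
qed

lemma supp_span_finite:
  assumes "x \<in> supp_span T"
  shows "\<exists>F\<subseteq>T. finite F \<and> x \<in> supp_span F"
  using assms unfolding supp_span_def
proof (induction rule: span_induct_alt)
  case base
  show ?case by (intro exI[of _ "{}"]) (auto simp: span_zero)
next
  case (step c x y)
  then obtain F g a where F: "F \<subseteq> T" "finite F" "y \<in> supp_span F" "x = lam g * \<iota> a" "g \<in> T"
    by (auto simp: supp_span_def)
  have "c *\<^sub>R x + y \<in> supp_span (insert g F)"
    using F supp_span_mono[of F "insert g F" y] supp_span_gen[of g "insert g F" a]
    by (auto intro!: supp_span_add supp_span_scale)
  with F show ?case by (intro exI[of _ "insert g F"]) (auto simp: supp_span_def)
qed

text \<open>The span is a *-algebra containing the generators, so its closure is one of the
  C*-subalgebras over which the hull is taken.\<close>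

lemma supp_span_dense: "closure (supp_span (carrier G)) = UNIV"
proof -
  let ?V = "supp_span (carrier G)"
  have blc: "bounded_linear (\<lambda>x::'b. c *\<^sub>C x)" for c
    by (rule bounded_linear_intro[where K = "cmod c"])
       (simp_all add: scaleC_add_right norm_scaleC scaleR_scaleC scaleC_scaleC mult.commute)
  have mult: "x * y \<in> ?V" if "x \<in> ?V" "y \<in> ?V" for x y
    by (rule supp_span_mult[OF that]) auto
  have scale: "c *\<^sub>C x \<in> ?V" if "x \<in> ?V" for c x
  proof (rule supp_span_linear_image[OF bounded_linear.linear[OF blc] _ subspace_supp_span that])
    fix g a assume "g \<in> carrier G"
    then show "c *\<^sub>C (lam g * \<iota> a) \<in> ?V"
      using supp_span_gen[of g "carrier G" "c *\<^sub>C a"] by (simp add: iota_scaleC scaleC_mult_right)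
  qed
  have lim: "l \<in> closure ?V" if "\<And>n. h n \<in> ?V" "h \<longlonglongrightarrow> l" for h l
    using that unfolding closure_sequential by blast
  have adj: "adj x \<in> ?V" if "x \<in> ?V" for x
    by (rule supp_span_adj[OF that]) auto
  have "cstar_subalgebra (closure ?V)"
    unfolding cstar_subalgebra_def
  proof (intro conjI ballI allI)
    show "0 \<in> closure ?V" using supp_span_zero closure_subset by blast
    fix x y assume "x \<in> closure ?V" "y \<in> closure ?V"
    then obtain f g where fg: "\<And>n. f n \<in> ?V" "f \<longlonglongrightarrow> x" "\<And>n. g n \<in> ?V" "g \<longlonglongrightarrow> y"
      unfolding closure_sequential by blast
    show "x + y \<in> closure ?V"
      by (rule lim[OF _ tendsto_add[OF fg(2,4)]]) (rule supp_span_add[OF fg(1,3)])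
    show "x * y \<in> closure ?V"
      by (rule lim[OF _ tendsto_mult[OF fg(2,4)]]) (rule mult[OF fg(1,3)])
  next
    fix c x assume "x \<in> closure ?V"
    then obtain f where f: "\<And>n. f n \<in> ?V" "f \<longlonglongrightarrow> x"
      unfolding closure_sequential by blast
    show "c *\<^sub>C x \<in> closure ?V"
      by (rule lim[OF _ bounded_linear.tendsto[OF blc f(2)]]) (rule scale[OF f(1)])
  next
    fix x assume "x \<in> closure ?V"
    then obtain f where f: "\<And>n. f n \<in> ?V" "f \<longlonglongrightarrow> x"
      unfolding closure_sequential by blast
    show "adj x \<in> closure ?V"
      by (rule lim[OF _ bounded_linear.tendsto[OF bounded_linear_adj f(2)]]) (rule adj[OF f(1)])
  qed simp
  moreover have "range \<iota> \<union> lam ` carrier G \<subseteq> closure ?V"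
  proof -
    have "\<iota> a \<in> ?V" for a
      using supp_span_gen[of \<one> "carrier G" a] by (simp add: lam_one)
    moreover have "lam g \<in> ?V" if "g \<in> carrier G" for g
      using supp_span_gen[OF that, of 1] by (simp add: iota_one)
    ultimately show ?thesis using closure_subset by blast
  qed
  ultimately have "cstar_subalgebra hull (range \<iota> \<union> lam ` carrier G) \<subseteq> closure ?V"
    by (rule hull_minimal[rotated])
  then show ?thesis by (simp add: generated top.extremum_unique)
qed

section \<open>Order estimates for the inner product\<close>

definition sq :: "'b \<Rightarrow> 'a"
  where "sq x = E (adj x * x)"

lemma pos_elem_sq: "pos_elem (sq x)"
  unfolding sq_def using E_pos pos_elem_adj_mult unfolding cstar_pos_iff by blast

lemma sq_add_orth:
  assumes "E (adj x * y) = 0" "E (adj y * x) = 0"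
  shows "sq (x + y) = sq x + sq y"
  using assms by (simp add: sq_def adj_add distrib_left distrib_right E_add)

lemma sq_sum: "sq (sum v I) = (\<Sum>i\<in>I. \<Sum>j\<in>I. E (adj (v i) * v j))"
  by (simp add: sq_def adj_sum sum_product E_sum)

lemma sq_sum_orth:
  assumes "finite I" "\<And>i j. i \<in> I \<Longrightarrow> j \<in> I \<Longrightarrow> i \<noteq> j \<Longrightarrow> E (adj (v i) * v j) = 0"
  shows "sq (sum v I) = (\<Sum>i\<in>I. sq (v i))"
proof -
  have "(\<Sum>j\<in>I. E (adj (v i) * v j)) = sq (v i)" if "i \<in> I" for i
  proof -
    have "(\<Sum>j\<in>I. E (adj (v i) * v j)) = (\<Sum>j\<in>I. if i = j then sq (v i) else 0)"
      using assms(2) that by (intro sum.cong) (auto simp: sq_def)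
    then show ?thesis using assms(1) that by simp
  qed
  then show ?thesis by (simp add: sq_sum)
qed

text \<open>With a root \<open>k\<close> of \<open>R\<^sup>2 *\<^sub>R 1 - adj y * y\<close>, the
  difference of the two sides is \<open>sq (k * x)\<close>.\<close>

lemma sq_mult_le:
  assumes "norm y \<le> R"
  shows "sq (y * x) \<preceq> R\<^sup>2 *\<^sub>R sq x"
proof -
  have "pos_elem (R\<^sup>2 *\<^sub>R 1 - adj y * y)"
    unfolding pos_elem_def using assms
    by (auto simp: adj_diff adj_scaleR adj_mult adj_adj cstar_identity
        intro!: exI[of _ "R\<^sup>2"] power_mono)
  then obtain k where k: "pos_elem k" "k * k = R\<^sup>2 *\<^sub>R 1 - adj y * y"
    using pos_elem_root by blast
  have "adj (k * x) * (k * x) = adj x * (k * k) * x"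
    by (simp add: adj_mult pos_elem_adj[OF k(1)] mult.assoc)
  also have "\<dots> = R\<^sup>2 *\<^sub>R (adj x * x) - adj (y * x) * (y * x)"
    by (simp add: k(2) algebra_simps adj_mult)
  finally have "sq (k * x) = R\<^sup>2 *\<^sub>R sq x - sq (y * x)"
    by (simp add: sq_def E_diff E_scaleR)
  then show ?thesis using pos_elem_sq[of "k * x"] by (simp add: pos_le_def)
qed

text \<open>Cauchy-Schwarz for sums: the gap is half the double sum of
  \<open>sq (v i - v j)\<close>.\<close>

lemma sq_sum_le: "sq (sum v I) \<preceq> real (card I) *\<^sub>R (\<Sum>i\<in>I. sq (v i))"
proof -
  let ?S = "\<Sum>i\<in>I. sq (v i)"
  have "(\<Sum>i\<in>I. \<Sum>j\<in>I. sq (v i - v j)) =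
      (\<Sum>i\<in>I. \<Sum>j\<in>I. sq (v i) + sq (v j) - E (adj (v i) * v j) - E (adj (v j) * v i))"
    by (simp add: sq_def adj_diff left_diff_distrib right_diff_distrib E_diff E_add algebra_simps)
  also have "\<dots> = (\<Sum>i\<in>I. \<Sum>j\<in>I. sq (v i)) + (\<Sum>i\<in>I. \<Sum>j\<in>I. sq (v j))
      - sq (sum v I) - (\<Sum>i\<in>I. \<Sum>j\<in>I. E (adj (v j) * v i))"
    by (simp add: sum_subtractf sum.distrib sq_sum)
  also have "(\<Sum>i\<in>I. \<Sum>j\<in>I. E (adj (v j) * v i)) = sq (sum v I)"
    by (subst sum.swap) (simp add: sq_sum)
  also have "(\<Sum>i\<in>I. \<Sum>j\<in>I. sq (v i)) = real (card I) *\<^sub>R ?S"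
    by (simp add: sum_constant_scaleR scaleR_sum_right)
  also have "(\<Sum>i\<in>I. \<Sum>j\<in>I. sq (v j)) = real (card I) *\<^sub>R ?S"
    by (simp add: sum_constant_scaleR)
  finally have eq: "(\<Sum>i\<in>I. \<Sum>j\<in>I. sq (v i - v j)) = 2 *\<^sub>R (real (card I) *\<^sub>R ?S - sq (sum v I))"
    by (simp add: scaleR_2)
  have "pos_elem ((1/2) *\<^sub>R (\<Sum>i\<in>I. \<Sum>j\<in>I. sq (v i - v j)))"
    by (intro pos_elem_scaleR pos_elem_sum pos_elem_sq) simp
  then show ?thesis by (simp add: eq pos_le_def)
qed

text \<open>The parallelogram law: the gap is \<open>sq (x - y)\<close>.\<close>

lemma sq_add_le: "sq (x + y) \<preceq> 2 *\<^sub>R (sq x + sq y)"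
proof -
  have "sq (x - y) = 2 *\<^sub>R (sq x + sq y) - sq (x + y)"
    by (simp add: sq_def adj_diff adj_add left_diff_distrib right_diff_distrib distrib_left
        distrib_right E_diff E_add scaleR_2)
  then show ?thesis using pos_elem_sq[of "x - y"] by (simp add: pos_le_def)
qed

text \<open>Each \<open>v j\<close> is the component of \<open>x\<close> over \<open>T j\<close>;
  what remains after subtracting all of them avoids every \<open>T j\<close> and so is orthogonal to
  their sum.\<close>

lemma bessel:
  assumes J: "finite J" and T: "\<And>j. j \<in> J \<Longrightarrow> T j \<subseteq> carrier G" "disjoint_family_on T J"
    and v: "\<And>j. j \<in> J \<Longrightarrow> v j \<in> supp_span (T j)"
      "\<And>j. j \<in> J \<Longrightarrow> x - v j \<in> supp_span (carrier G - T j)"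
  shows "(\<Sum>j\<in>J. sq (v j)) \<preceq> sq x"
proof -
  define r where "r = x - sum v J"
  have r: "r \<in> supp_span (carrier G - T j)" if j: "j \<in> J" for j
  proof -
    have "r = (x - v j) - sum v (J - {j})"
      using J j by (simp add: r_def sum.remove)
    moreover have "sum v (J - {j}) \<in> supp_span (carrier G - T j)"
    proof (rule supp_span_sum)
      fix i assume i: "i \<in> J - {j}"
      then have "T i \<subseteq> carrier G - T j"
        using T j unfolding disjoint_family_on_def by blast
      then show "v i \<in> supp_span (carrier G - T j)" using v(1) i supp_span_mono by blast
    qed
    ultimately show ?thesis using v(2)[OF j] by (simp add: supp_span_diff)
  qed
  have "E (adj (v j) * r) = 0" "E (adj r * v j) = 0" if "j \<in> J" for j
    by (rule supp_span_orth[OF v(1)[OF that] r[OF that]] supp_span_orth[OF r[OF that] v(1)[OF that]];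
        use T that in auto)+
  then have "sq (sum v J + r) = sq (sum v J) + sq r"
    by (intro sq_add_orth) (simp_all add: adj_sum sum_distrib_left sum_distrib_right E_sum)
  moreover have "sq (sum v J) = (\<Sum>j\<in>J. sq (v j))"
  proof (rule sq_sum_orth[OF J])
    fix i j assume "i \<in> J" "j \<in> J" "i \<noteq> j"
    then show "E (adj (v i) * v j) = 0"
      using T by (intro supp_span_orth[OF v(1) v(1)]) (auto simp: disjoint_family_on_def)
  qed
  moreover have "sum v J + r = x" by (simp add: r_def)
  ultimately show ?thesis using pos_le_add_right[OF pos_elem_sq[of r]] by simp
qed

section \<open>Powers averaging\<close>

text \<open>By \<open>large\<close>, \<open>y\<close> sends the part of \<open>x\<close> outside the
  union of the \<open>T k\<close> into that union. So the part \<open>s\<close> of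
  \<open>y * x\<close> outside comes from the part of \<open>x\<close> inside alone, which is why
  its bound involves only the \<open>xc k\<close>.\<close>

lemma large_split:
  assumes K: "finite K" and T: "\<And>k. k \<in> K \<Longrightarrow> T k \<subseteq> carrier G" "disjoint_family_on T K"
    and F: "F \<subseteq> carrier G" "y \<in> supp_span F" and y: "norm y \<le> R"
    and large: "\<And>f u. f \<in> F \<Longrightarrow> u \<in> carrier G - (\<Union>k\<in>K. T k) \<Longrightarrow> f \<otimes> u \<in> (\<Union>k\<in>K. T k)"
    and x: "x \<in> supp_span (carrier G)"
  shows "\<exists>xc z s. (\<forall>k\<in>K. xc k \<in> supp_span (T k) \<and> x - xc k \<in> supp_span (carrier G - T k)) \<and>
    (\<forall>k\<in>K. z k \<in> supp_span (T k)) \<and> y * x = sum z K + s \<and>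
    (\<Sum>k\<in>K. sq (z k)) \<preceq> R\<^sup>2 *\<^sub>R sq x \<and> sq s \<preceq> R\<^sup>2 *\<^sub>R (\<Sum>k\<in>K. sq (xc k))"
proof -
  define D where "D = (\<Union>k\<in>K. T k)"
  have D: "D \<subseteq> carrier G" using T(1) by (auto simp: D_def)
  have TD: "T k \<subseteq> D" if "k \<in> K" for k using that by (auto simp: D_def)
  have orth: "E (adj (v i) * v j) = 0"
    if "\<forall>k\<in>K. v k \<in> supp_span (T k)" "i \<in> K" "j \<in> K" "i \<noteq> j" for v i j
    using that T by (intro supp_span_orth[of _ "T i" _ "T j"]) (auto simp: disjoint_family_on_def)
  have in_D: "sum v K \<in> supp_span D" if "\<forall>k\<in>K. v k \<in> supp_span (T k)" for v
    using that TD by (intro supp_span_sum) (blast intro: supp_span_mono)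
  have sq_split: "sq (sum v K + r) = (\<Sum>k\<in>K. sq (v k)) + sq r"
    if v: "\<forall>k\<in>K. v k \<in> supp_span (T k)" and r: "r \<in> supp_span (carrier G - D)" for v r
  proof -
    have "sq (sum v K + r) = sq (sum v K) + sq r"
      using D by (intro sq_add_orth supp_span_orth[OF in_D[OF v] r] supp_span_orth[OF r in_D[OF v]]) auto
    also have "sq (sum v K) = (\<Sum>k\<in>K. sq (v k))"
      using K orth[OF v] by (intro sq_sum_orth)
    finally show ?thesis .
  qed
  obtain xc r where xc: "\<forall>k\<in>K. xc k \<in> supp_span (T k)" and r: "r \<in> supp_span (carrier G - D)"
    and xeq: "x = sum xc K + r"
    using supp_span_split[OF K x, of T] unfolding D_def by blast
  have "sum xc K \<in> supp_span (carrier G)" using in_D[OF xc] D supp_span_mono by blast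
  then have "y * sum xc K \<in> supp_span (carrier G)"
    by (rule supp_span_mult[OF F(2)]) (use F(1) in auto)
  then obtain z' s where z': "\<forall>k\<in>K. z' k \<in> supp_span (T k)" and s: "s \<in> supp_span (carrier G - D)"
    and z'eq: "y * sum xc K = sum z' K + s"
    using supp_span_split[OF K, of _ T] unfolding D_def by blast
  have "y * r \<in> supp_span D"
    by (rule supp_span_mult[OF F(2) r]) (use F(1) large in \<open>auto simp: D_def\<close>)
  then obtain z'' where z'': "\<forall>k\<in>K. z'' k \<in> supp_span (T k)" and z''eq: "y * r = sum z'' K"
    using supp_span_UN[OF K, of _ T] unfolding D_def by blast
  \<comment> \<open>\<open>z'\<close> comes from the part of \<open>x\<close> over \<open>D\<close>,
    and \<open>z''\<close> from the part outside.\<close>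
  define z where "z k = z' k + z'' k" for k
  have z: "\<forall>k\<in>K. z k \<in> supp_span (T k)"
    using z' z'' by (auto simp: z_def supp_span_add)
  have yx: "y * x = sum z K + s"
    by (simp add: xeq distrib_left z'eq z''eq z_def sum.distrib algebra_simps)
  have "(\<Sum>k\<in>K. sq (z k)) \<preceq> (\<Sum>k\<in>K. sq (z k)) + sq s"
    by (rule pos_le_add_right[OF pos_elem_sq])
  also have "\<dots> = sq (y * x)" unfolding yx by (rule sq_split[OF z s, symmetric])
  also have "\<dots> \<preceq> R\<^sup>2 *\<^sub>R sq x" by (rule sq_mult_le[OF y])
  finally have A: "(\<Sum>k\<in>K. sq (z k)) \<preceq> R\<^sup>2 *\<^sub>R sq x" .
  have "sq s \<preceq> sq s + (\<Sum>k\<in>K. sq (z' k))"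
    by (intro pos_le_add_right pos_elem_sum pos_elem_sq)
  also have "\<dots> = sq (y * sum xc K)"
    unfolding z'eq sq_split[OF z' s] by (rule add.commute)
  also have "\<dots> \<preceq> R\<^sup>2 *\<^sub>R sq (sum xc K)" by (rule sq_mult_le[OF y])
  also have "sq (sum xc K) = (\<Sum>k\<in>K. sq (xc k))"
    using K orth[OF xc] by (intro sq_sum_orth)
  finally have B: "sq s \<preceq> R\<^sup>2 *\<^sub>R (\<Sum>k\<in>K. sq (xc k))" .
  have "x - xc k \<in> supp_span (carrier G - T k)" if k: "k \<in> K" for k
  proof -
    have "x - xc k = sum xc (K - {k}) + r" using K k by (simp add: xeq sum.remove)
    moreover have "xc i \<in> supp_span (carrier G - T k)" if i: "i \<in> K - {k}" for i
    proof (rule supp_span_mono)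
      show "T i \<subseteq> carrier G - T k" using T i k unfolding disjoint_family_on_def by blast
    qed (use xc i in auto)
    moreover have "r \<in> supp_span (carrier G - T k)"
      by (rule supp_span_mono[OF _ r]) (use TD[OF k] in auto)
    ultimately show ?thesis by (simp only: supp_span_add supp_span_sum)
  qed
  with xc z yx A B show ?thesis by blast
qed

text \<open>
  Splitting each \<open>y j * x\<close> into its part over the large set \<open>\<Union>k. T j k\<close> and the remainder,
  the first parts are almost orthogonal for different \<open>j\<close>, and the remainders are controlled by
  the almost orthogonal parts of \<open>x\<close> over these sets.
\<close>

lemma norm_sum_large_le:
  assumes JK: "finite J" "finite K" and R: "R \<ge> 0"
    and T: "\<And>j k. j \<in> J \<Longrightarrow> k \<in> K \<Longrightarrow> T j k \<subseteq> carrier G"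
      "\<And>j. j \<in> J \<Longrightarrow> disjoint_family_on (T j) K"
      "\<And>k. k \<in> K \<Longrightarrow> disjoint_family_on (\<lambda>j. T j k) J"
    and y: "\<And>j. j \<in> J \<Longrightarrow> F j \<subseteq> carrier G" "\<And>j. j \<in> J \<Longrightarrow> y j \<in> supp_span (F j)"
      "\<And>j. j \<in> J \<Longrightarrow> norm (y j) \<le> R"
    and large: "\<And>j f u. j \<in> J \<Longrightarrow> f \<in> F j \<Longrightarrow> u \<in> carrier G - (\<Union>k\<in>K. T j k) \<Longrightarrow>
      f \<otimes> u \<in> (\<Union>k\<in>K. T j k)"
  shows "norm (sum y J) \<le> 2 * R * sqrt (card J * card K)"
proof -
  \<comment> \<open>\<open>A\<close> and \<open>B\<close> below each contribute
    \<open>card J * card K * R\<^sup>2\<close>; \<open>sq_add_le\<close> doubles their sum.\<close>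
  define c where "c = 4 * R\<^sup>2 * (real (card J) * real (card K))"
  have core: "sq (sum y J * x) \<preceq> c *\<^sub>R sq x" if x: "x \<in> supp_span (carrier G)" for x
  proof -
    let ?P = "\<lambda>j xc z s. (\<forall>k\<in>K. xc k \<in> supp_span (T j k) \<and> x - xc k \<in> supp_span (carrier G - T j k)) \<and>
      (\<forall>k\<in>K. z k \<in> supp_span (T j k)) \<and> y j * x = sum z K + s \<and>
      (\<Sum>k\<in>K. sq (z k)) \<preceq> R\<^sup>2 *\<^sub>R sq x \<and> sq s \<preceq> R\<^sup>2 *\<^sub>R (\<Sum>k\<in>K. sq (xc k))"
    have "\<exists>w. ?P j (fst w) (fst (snd w)) (snd (snd w))" if j: "j \<in> J" for j
      using large_split[OF JK(2) T(1)[OF j] T(2)[OF j] y(1)[OF j] y(2)[OF j] y(3)[OF j] large[OF j] x]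
      by simp
    then obtain w where w: "\<And>j. j \<in> J \<Longrightarrow> ?P j (fst (w j)) (fst (snd (w j))) (snd (snd (w j)))"
      by metis
    define xc z s where "xc j = fst (w j)" and "z j = fst (snd (w j))" and "s j = snd (snd (w j))" for j
    have P: "?P j (xc j) (z j) (s j)" if "j \<in> J" for j
      using w[OF that] unfolding xc_def z_def s_def .
    let ?n = "real (card K)" and ?N = "real (card J)"
    \<comment> \<open>The sum over \<open>j\<close> is inside because only for a fixed
      \<open>k\<close> are the sets \<open>T j k\<close> disjoint in \<open>j\<close>;
      Cauchy-Schwarz over \<open>K\<close> alone then costs \<open>card K\<close>.\<close>
    define A where "A = (\<Sum>k\<in>K. \<Sum>j\<in>J. z j k)"
    define B where "B = sum s J"
    have "sum y J * x = (\<Sum>j\<in>J. sum (z j) K + s j)"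
      unfolding sum_distrib_right by (rule sum.cong) (use P in auto)
    also have "\<dots> = A + B"
      by (simp add: A_def B_def sum.distrib) (rule sum.swap)
    finally have eq: "sum y J * x = A + B" .
    have orth: "sq (\<Sum>j\<in>J. z j k) = (\<Sum>j\<in>J. sq (z j k))" if k: "k \<in> K" for k
    proof (rule sq_sum_orth[OF JK(1)])
      fix i j assume ij: "i \<in> J" "j \<in> J" "i \<noteq> j"
      then have "T i k \<inter> T j k = {}" using T(3)[OF k] by (auto simp: disjoint_family_on_def)
      then show "E (adj (z i k) * z j k) = 0"
        using P[OF ij(1)] P[OF ij(2)] k T(1)[OF ij(1) k] T(1)[OF ij(2) k]
        by (intro supp_span_orth[of _ "T i k" _ "T j k"]) auto
    qed
    have "sq A \<preceq> ?n *\<^sub>R (\<Sum>k\<in>K. sq (\<Sum>j\<in>J. z j k))"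
      unfolding A_def by (rule sq_sum_le)
    also have "(\<Sum>k\<in>K. sq (\<Sum>j\<in>J. z j k)) = (\<Sum>j\<in>J. \<Sum>k\<in>K. sq (z j k))"
      by (subst sum.swap) (simp add: orth)
    also have "?n *\<^sub>R (\<Sum>j\<in>J. \<Sum>k\<in>K. sq (z j k)) \<preceq> ?n *\<^sub>R (\<Sum>j\<in>J. R\<^sup>2 *\<^sub>R sq x)"
      using P by (intro pos_le_scaleR_mono pos_le_sum_mono) auto
    also have "?n *\<^sub>R (\<Sum>j\<in>J. R\<^sup>2 *\<^sub>R sq x) = (?n * ?N * R\<^sup>2) *\<^sub>R sq x"
      by (simp add: sum_constant_scaleR mult.assoc)
    finally have A: "sq A \<preceq> (?n * ?N * R\<^sup>2) *\<^sub>R sq x" .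
    have bes: "(\<Sum>j\<in>J. sq (xc j k)) \<preceq> sq x" if k: "k \<in> K" for k
      using P k T by (intro bessel[OF JK(1), of "\<lambda>j. T j k"]) auto
    \<comment> \<open>Here Cauchy-Schwarz costs \<open>card J\<close>, which is affordable since
      Bessel bounds the sum over \<open>j\<close> by one \<open>sq x\<close> for each
      \<open>k\<close>.\<close>
    have "sq B \<preceq> ?N *\<^sub>R (\<Sum>j\<in>J. sq (s j))"
      unfolding B_def by (rule sq_sum_le)
    also have "\<dots> \<preceq> ?N *\<^sub>R (\<Sum>j\<in>J. R\<^sup>2 *\<^sub>R (\<Sum>k\<in>K. sq (xc j k)))"
      using P by (intro pos_le_scaleR_mono pos_le_sum_mono) auto
    also have "(\<Sum>j\<in>J. R\<^sup>2 *\<^sub>R (\<Sum>k\<in>K. sq (xc j k))) = R\<^sup>2 *\<^sub>R (\<Sum>k\<in>K. \<Sum>j\<in>J. sq (xc j k))"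
      by (subst sum.swap) (simp add: scaleR_sum_right)
    also have "?N *\<^sub>R (R\<^sup>2 *\<^sub>R (\<Sum>k\<in>K. \<Sum>j\<in>J. sq (xc j k))) \<preceq> ?N *\<^sub>R (R\<^sup>2 *\<^sub>R (\<Sum>k\<in>K. sq x))"
      using bes by (intro pos_le_scaleR_mono pos_le_sum_mono) auto
    also have "\<dots> = (?n * ?N * R\<^sup>2) *\<^sub>R sq x"
      by (simp add: sum_constant_scaleR mult.assoc mult.commute mult.left_commute)
    finally have B: "sq B \<preceq> (?n * ?N * R\<^sup>2) *\<^sub>R sq x" .
    have "sq (A + B) \<preceq> 2 *\<^sub>R (sq A + sq B)" by (rule sq_add_le)
    also have "\<dots> \<preceq> 2 *\<^sub>R ((?n * ?N * R\<^sup>2) *\<^sub>R sq x + (?n * ?N * R\<^sup>2) *\<^sub>R sq x)"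
      by (intro pos_le_scaleR_mono pos_le_add_mono A B) simp
    also have "\<dots> = c *\<^sub>R sq x"
      by (simp add: c_def mult.commute mult.left_commute flip: scaleR_add_left)
    finally show ?thesis by (simp add: eq)
  qed
  \<comment> \<open>The splitting needed finite support; density of the span and closedness of the
    cone remove that restriction.\<close>
  have "pos_elem (c *\<^sub>R E (adj x * x) - E (adj (sum y J * x) * (sum y J * x)))" for x
  proof -
    obtain f where f: "\<And>n. f n \<in> supp_span (carrier G)" "f \<longlonglongrightarrow> x"
      using supp_span_dense closure_sequential[of x "supp_span (carrier G)"] by auto
    note lims = tendsto_intros f(2) bounded_linear.tendsto[OF E_bounded_linear]
      bounded_linear.tendsto[OF bounded_linear_adj]
    have "(\<lambda>n. c *\<^sub>R E (adj (f n) * f n) - E (adj (sum y J * f n) * (sum y J * f n)))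
      \<longlonglongrightarrow> c *\<^sub>R E (adj x * x) - E (adj (sum y J * x) * (sum y J * x))"
      by (intro lims)
    then have "c *\<^sub>R E (adj x * x) - E (adj (sum y J * x) * (sum y J * x)) \<in> {p. pos_elem p}"
      by (rule Lim_in_closed_set[OF closed_pos_elem _ sequentially_bot, rotated])
         (use core[OF f(1)] in \<open>simp add: pos_le_def sq_def\<close>)
    then show ?thesis by simp
  qed
  then have "(norm (sum y J))\<^sup>2 \<le> \<bar>c\<bar>"
    using E_expectation E_faithful
    by (intro norm_le_of_faithful[of E]) (auto simp: conditional_expectation_def)
  also have "\<bar>c\<bar> = (2 * R * sqrt (card J * card K))\<^sup>2"
    by (simp add: c_def power_mult_distrib)
  finally show ?thesis by (rule power2_le_imp_le) (simp add: R)
qed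

section \<open>Means over group elements\<close>

definition conj_mean :: "(nat \<Rightarrow> 'g) \<Rightarrow> nat \<Rightarrow> 'b \<Rightarrow> 'b"
  where "conj_mean h N z = (1 / real N) *\<^sub>R (\<Sum>j\<in>{1..N}. lam (h j) * z * adj (lam (h j)))"

lemma linear_conj_mean: "linear (conj_mean h N)"
  by (rule linearI)
    (simp_all add: conj_mean_def distrib_left distrib_right sum.distrib scaleR_add_right scaleR_sum_right)

lemma conj_mean_in_conj_hull:
  assumes h: "h ` {1..N} \<subseteq> carrier G" and N: "N \<ge> 1" and z: "z \<in> conj_hull y"
  shows "conj_mean h N z \<in> conj_hull y"
proof -
  have "(\<Sum>j\<in>{1..N}. (1 / real N) *\<^sub>R (lam (h j) * z * adj (lam (h j)))) \<in> conj_hull y"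
  proof (rule convex_sum)
    show "convex (conj_hull y)" by (simp add: conj_hull_def)
    show "lam (h j) * z * adj (lam (h j)) \<in> conj_hull y" if "j \<in> {1..N}" for j
      using that h by (intro conj_hull_conj lam_unitary z) auto
  qed (use N in auto)
  then show ?thesis by (simp add: conj_mean_def scaleR_sum_right)
qed

lemma supp_span_conj:
  assumes h: "h \<in> carrier G" and z: "z \<in> supp_span F" and F: "F \<subseteq> carrier G"
  shows "lam h * z * adj (lam h) \<in> supp_span {h \<otimes> f \<otimes> inv h | f. f \<in> F}"
proof -
  have lh: "lam h \<in> supp_span {h}" using supp_span_gen[of h "{h}" 1] by (simp add: iota_one)
  then have adj: "adj (lam h) \<in> supp_span {inv h}"
    using h by (rule_tac supp_span_adj) auto
  have "lam h * z \<in> supp_span {h \<otimes> f | f. f \<in> F}"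
    by (rule supp_span_mult[OF lh z]) (use h F in auto)
  then show ?thesis
    by (rule supp_span_mult[OF _ adj]) (use h F in auto)
qed

text \<open>The index \<open>k\<close> counts layers. Large sets for different \<open>j\<close> may
  overlap, but each layer is disjoint in \<open>j\<close>, and the layers cost a factor
  \<open>sqrt (card K)\<close>. The sum grows like \<open>sqrt N\<close>, while the mean divides by
  \<open>N\<close>.\<close>

lemma norm_conj_mean_le:
  assumes N: "N \<ge> 1" and h: "h ` {1..N} \<subseteq> carrier G" and K: "finite K"
    and w: "w \<in> supp_span F" and F: "F \<subseteq> carrier G"
    and T: "\<And>j k. j \<in> {1..N} \<Longrightarrow> k \<in> K \<Longrightarrow> T j k \<subseteq> carrier G"
      "\<And>j. j \<in> {1..N} \<Longrightarrow> disjoint_family_on (T j) K"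
      "\<And>k. k \<in> K \<Longrightarrow> disjoint_family_on (\<lambda>j. T j k) {1..N}"
    and large: "\<And>j f u. j \<in> {1..N} \<Longrightarrow> f \<in> F \<Longrightarrow> u \<in> carrier G - (\<Union>k\<in>K. T j k) \<Longrightarrow>
      h j \<otimes> f \<otimes> inv (h j) \<otimes> u \<in> (\<Union>k\<in>K. T j k)"
  shows "norm (conj_mean h N w) \<le> 2 * norm w * sqrt (real (card K) / real N)"
proof -
  let ?y = "\<lambda>j. lam (h j) * w * adj (lam (h j))"
  have hc: "h j \<in> carrier G" if "j \<in> {1..N}" for j using h that by auto
  have "norm (sum ?y {1..N}) \<le> 2 * norm w * sqrt (card {1..N} * card K)"
  proof (rule norm_sum_large_le[OF _ K _ T])
    fix j assume j: "j \<in> {1..N}"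
    show "?y j \<in> supp_span {h j \<otimes> f \<otimes> inv h j | f. f \<in> F}"
      by (rule supp_span_conj[OF hc[OF j] w F])
    show "{h j \<otimes> f \<otimes> inv h j | f. f \<in> F} \<subseteq> carrier G" using hc[OF j] F by auto
    show "norm (?y j) \<le> norm w" by (rule norm_unitary_conj_le[OF lam_unitary[OF hc[OF j]]])
    fix f u assume "f \<in> {h j \<otimes> f \<otimes> inv h j | f. f \<in> F}" "u \<in> carrier G - (\<Union>k\<in>K. T j k)"
    then show "f \<otimes> u \<in> (\<Union>k\<in>K. T j k)" using large[OF j] by blast
  qed auto
  then have "norm (conj_mean h N w) \<le> (1 / real N) * (2 * norm w * sqrt (real N * card K))"
    unfolding conj_mean_def by (simp add: divide_right_mono)
  also have "\<dots> = 2 * norm w * (sqrt (real N) / real N * sqrt (card K))"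
    by (simp add: real_sqrt_mult)
  also have "sqrt (real N) / real N = 1 / sqrt (real N)"
    using N by (simp add: real_div_sqrt field_simps)
  finally show ?thesis by (simp add: real_sqrt_divide)
qed

text \<open>The averaging is demanded as a linear map since it is chosen for a finitely supported
  \<open>v\<close> and then applied to \<open>y\<close>. Lying in \<open>conj_hull x\<close> for
  every \<open>x\<close> makes it contractive, which controls \<open>y - v\<close>.\<close>

lemma property_DP_if_averaging:
  assumes avg: "\<And>F v \<delta>. finite F \<Longrightarrow> F \<noteq> {} \<Longrightarrow> F \<subseteq> carrier G - {\<one>} \<Longrightarrow> v \<in> supp_span F \<Longrightarrow> \<delta> > 0 \<Longrightarrow>
    \<exists>\<Psi>. linear \<Psi> \<and> (\<forall>x. \<Psi> x \<in> conj_hull x) \<and> norm (\<Psi> v) \<le> \<delta>"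
  shows "property_DP E"
  unfolding property_DP_def
proof (intro allI impI)
  fix y :: 'b assume y: "adj y = y \<and> E y = 0"
  have "\<exists>z\<in>conj_hull y. dist z 0 < \<epsilon>" if \<epsilon>: "\<epsilon> > 0" for \<epsilon>
  proof -
    have "y \<in> closure (supp_span (carrier G))" by (simp add: supp_span_dense)
    \<comment> \<open>One quarter is for approximating \<open>y\<close>, one for dropping the
      coefficient at the identity; the remaining half is for the mean of \<open>v\<close>.\<close>
    then obtain y0 where y0: "y0 \<in> supp_span (carrier G)" "dist y0 y < \<epsilon> / 4"
      using \<epsilon> by (metis closure_approachable divide_pos_pos zero_less_numeral)
    then have "y0 \<in> supp_span ({\<one>} \<union> (carrier G - {\<one>}))"
      using supp_span_mono[of "carrier G" "{\<one>} \<union> (carrier G - {\<one>})"] by blast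
    then obtain u v where uv: "u \<in> supp_span {\<one>}" "v \<in> supp_span (carrier G - {\<one>})" "y0 = u + v"
      using supp_span_Un by blast
    \<comment> \<open>The part at the identity is recovered from its expectation, and it is small
      since \<open>E\<close> vanishes on \<open>y\<close> and on \<open>v\<close>.\<close>
    have "u - \<iota> (E u) \<in> {0}"
    proof (rule supp_span_linear_image[OF _ _ _ uv(1), of "\<lambda>u. u - \<iota> (E u)"])
      show "linear (\<lambda>u. u - \<iota> (E u))"
        by (rule linearI) (simp_all add: E_add iota_add E_scaleR iota_scaleR scaleR_diff_right)
    qed (simp_all add: lam_one E_iota)
    then have u: "u = \<iota> (E u)" by simp
    have "E u = E (y0 - y)"
      using uv y E_supp_span[OF uv(2)] by (simp add: E_add E_diff)
    then have Eu: "norm (E u) < \<epsilon> / 4"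
      using E_norm[of "y0 - y"] y0(2) by (simp add: dist_norm)
    then have "norm u < \<epsilon> / 4" using norm_iota_le[of "E u"] u by simp
    then have yv: "norm (y - v) < \<epsilon> / 2"
      using y0(2) uv(3) norm_triangle_ineq[of "y - y0" u] by (simp add: dist_norm norm_minus_commute)
    obtain F where F: "F \<subseteq> carrier G - {\<one>}" "finite F" "v \<in> supp_span F"
      using supp_span_finite[OF uv(2)] by blast
    have "\<exists>\<Psi>. linear \<Psi> \<and> (\<forall>x. \<Psi> x \<in> conj_hull x) \<and> norm (\<Psi> v) \<le> \<epsilon> / 2"
    \<comment> \<open>Both group conditions speak of non-empty \<open>F\<close> only.\<close>
    proof (cases "F = {}")
      case True
      with F have "v = 0" by (simp add: supp_span_empty)
      then show ?thesis using \<epsilon> by (intro exI[of _ id]) (simp add: linear_id self_in_conj_hull)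
    next
      case False
      show ?thesis using \<epsilon> by (intro avg[OF F(2) False F(1,3)]) simp
    qed
    then obtain \<Psi> where \<Psi>: "linear \<Psi>" "\<And>x. \<Psi> x \<in> conj_hull x" "norm (\<Psi> v) \<le> \<epsilon> / 2"
      by blast
    have "\<Psi> y = \<Psi> (y - v) + \<Psi> v" using linear_diff[OF \<Psi>(1)] by simp
    then have "norm (\<Psi> y) \<le> norm (\<Psi> (y - v)) + norm (\<Psi> v)" by (simp add: norm_triangle_ineq)
    also have "\<dots> < \<epsilon> / 2 + \<epsilon> / 2"
      using norm_conj_hull_le[OF \<Psi>(2)] yv \<Psi>(3) by (meson add_less_le_mono order_le_less_trans)
    finally show ?thesis using \<Psi>(2) by auto
  qed
  then show "0 \<in> closure (convex hull {v * y * adj v | v. v \<in> unitaries})"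
    by (simp add: closure_approachable flip: conj_hull_def)
qed

section \<open>Groups with property (P_com)\<close>

text \<open>The averaging uses the powers of \<open>g0\<close>, and the large sets are translates of
  the complement of \<open>U\<close>, cut into \<open>n\<close> layers. Condition (iii) makes the
  translates of each layer disjoint, (ii) makes the sets large.\<close>

lemma P_com_averaging:
  assumes G: "P_com G" and F: "finite F" "F \<noteq> {}" "F \<subseteq> carrier G - {\<one>}"
    and v: "v \<in> supp_span F" and \<delta>: "\<delta> > 0"
  shows "\<exists>\<Psi>. linear \<Psi> \<and> (\<forall>x. \<Psi> x \<in> conj_hull x) \<and> norm (\<Psi> v) \<le> \<delta>"
proof -
  from G F obtain n :: nat and g0 U D where
    g0: "g0 \<in> carrier G" and U: "U \<subseteq> carrier G" and D: "\<And>k. k \<in> {1..n} \<Longrightarrow> D k \<subseteq> carrier G"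
    and cover: "carrier G - U \<subseteq> (\<Union>k\<in>{1..n}. D k)"
    and FU: "\<And>g. g \<in> F \<Longrightarrow> (g <# U) \<inter> U = {}"
    and disj: "\<And>j k. (j::nat) \<ge> 1 \<Longrightarrow> k \<in> {1..n} \<Longrightarrow> ((g0 [^] (- int j)) <# D k) \<inter> D k = {}"
    unfolding P_com_def by metis
  \<comment> \<open>The \<open>D k\<close> may overlap and meet \<open>U\<close>; the
    \<open>D' k\<close> partition its complement.\<close>
  define D' where "D' k = (D k - U) - (\<Union>i\<in>{1..<k}. D i)" for k
  have D'D: "D' k \<subseteq> D k" for k by (auto simp: D'_def)
  have D'_cover: "\<exists>k\<in>{1..n}. g \<in> D' k" if g: "g \<in> carrier G" "g \<notin> U" for g
  proof -
    define k where "k = (LEAST k. k \<ge> 1 \<and> g \<in> D k)"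
    obtain i where i: "i \<in> {1..n}" "g \<in> D i" using g cover by auto
    then have k: "k \<ge> 1 \<and> g \<in> D k" 
      using LeastI[of "\<lambda>k. k \<ge> 1 \<and> g \<in> D k" i] by (simp add: k_def)
    have "k \<le> i"
      using Least_le[of "\<lambda>k. k \<ge> 1 \<and> g \<in> D k" i] i by (simp add: k_def)
    moreover have "g \<notin> D l" if "l \<in> {1..<k}" for l
      using not_less_Least[of l "\<lambda>k. k \<ge> 1 \<and> g \<in> D k"] that by (auto simp: k_def)
    ultimately show ?thesis using k i g by (intro bexI[of _ k]) (auto simp: D'_def)
  qed
  have D'_disj: "D' k \<inter> D' l = {}" if "k < l" "k \<ge> 1" for k l
    using that by (auto simp: D'_def)
  have D'_inj: "k = l" if "g \<in> D' k" "g \<in> D' l" "k \<in> {1..n}" "l \<in> {1..n}" for g k l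
    using D'_disj[of k l] D'_disj[of l k] that by (cases k l rule: linorder_cases) auto
  obtain N where N: "N \<ge> 1" "2 * norm v * sqrt (real n / real N) \<le> \<delta>"
    using ex_large_count[OF \<delta>, of "norm v" "real n"] by auto
  define h where "h j = g0 [^] j" for j :: nat
  have h: "h j \<in> carrier G" for j using g0 by (simp add: h_def)
  define T where "T j k = {g \<in> carrier G. inv (h j) \<otimes> g \<in> D' k}" for j k
  \<comment> \<open>Condition (iii) speaks of negative powers of \<open>g0\<close>, so the translate
    with the larger exponent is expressed through the other one.\<close>
  have h_diff: "inv (h j) \<otimes> g = (g0 [^] (- int (j - i))) \<otimes> (inv (h i) \<otimes> g)"
    if "i < j" "g \<in> carrier G" for i j g
  proof -
    have "h j = h i \<otimes> h (j - i)"
      using that g0 by (simp add: h_def nat_pow_mult)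
    then have "inv (h j) = inv (h (j - i)) \<otimes> inv (h i)"
      using h by (simp add: inv_mult_group)
    moreover have "g0 [^] (- int (j - i)) = inv (h (j - i))"
      using g0 by (simp only: int_pow_neg int_pow_int h_def)
    ultimately show ?thesis using that h by (simp add: m_assoc)
  qed
  have T_disj: "T i k \<inter> T j k = {}" if ij: "i < j" and k: "k \<in> {1..n}" for i j k
  proof (rule ccontr)
    assume "T i k \<inter> T j k \<noteq> {}"
    then obtain g where g: "g \<in> carrier G" "inv (h i) \<otimes> g \<in> D k" "inv (h j) \<otimes> g \<in> D k"
      using D'D by (auto simp: T_def)
    then have "inv (h j) \<otimes> g \<in> (g0 [^] (- int (j - i))) <# D k"
      unfolding h_diff[OF ij g(1)] l_coset_def by auto
    moreover have "1 \<le> j - i" using ij by simp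
    ultimately show False using disj[OF _ k] g(3) by blast
  qed
  have "norm (conj_mean h N v) \<le> 2 * norm v * sqrt (real (card {1..n}) / real N)"
  proof (rule norm_conj_mean_le[OF N(1) _ _ v, of _ _ T])
    show "disjoint_family_on (T j) {1..n}" for j
      unfolding disjoint_family_on_def T_def using D'_inj by blast
    show "disjoint_family_on (\<lambda>j. T j k) {1..N}" if "k \<in> {1..n}" for k
      unfolding disjoint_family_on_def using T_disj[OF _ that] by (metis Int_commute linorder_neqE_nat)
    fix j f u assume f: "f \<in> F" and u: "u \<in> carrier G - (\<Union>k\<in>{1..n}. T j k)"
    have fc: "f \<in> carrier G" using f F by auto
    have uc: "u \<in> carrier G" using u by auto
    \<comment> \<open>Translated back by \<open>h j\<close>, the point lies in \<open>U\<close>;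
      then \<open>f\<close> moves it out of \<open>U\<close>, that is, into some
      \<open>D' k\<close>.\<close>
    have "inv (h j) \<otimes> u \<in> U"
      using D'_cover[of "inv (h j) \<otimes> u"] u uc h by (auto simp: T_def)
    then have "f \<otimes> (inv (h j) \<otimes> u) \<in> f <# U" by (auto simp: l_coset_def)
    then have "f \<otimes> (inv (h j) \<otimes> u) \<notin> U" using FU[OF f] by auto
    moreover have "f \<otimes> (inv (h j) \<otimes> u) = inv (h j) \<otimes> (h j \<otimes> f \<otimes> inv (h j) \<otimes> u)"
      using fc uc h by (simp add: m_assoc flip: m_assoc[of "inv (h j)" "h j"])
    ultimately have "inv (h j) \<otimes> (h j \<otimes> f \<otimes> inv (h j) \<otimes> u) \<notin> U" by simp
    then obtain k where "k \<in> {1..n}" "inv (h j) \<otimes> (h j \<otimes> f \<otimes> inv (h j) \<otimes> u) \<in> D' k"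
      using D'_cover fc uc h by (metis inv_closed m_closed)
    then show "h j \<otimes> f \<otimes> inv (h j) \<otimes> u \<in> (\<Union>k\<in>{1..n}. T j k)"
      using fc uc h by (auto simp: T_def)
  qed (use F h in \<open>auto simp: T_def\<close>)
  then have "norm (conj_mean h N v) \<le> \<delta>" using N(2) by simp
  moreover have "conj_mean h N x \<in> conj_hull x" for x
    using h by (intro conj_mean_in_conj_hull self_in_conj_hull N(1)) auto
  ultimately show ?thesis using linear_conj_mean by blast
qed

section \<open>PH groups\<close>

lemma powers_set_averaging:
  assumes P: "powers_set G F H" and w: "w \<in> supp_span F" and \<delta>: "\<delta> > 0"
  shows "\<exists>N h. N \<ge> 1 \<and> h ` {1..N} \<subseteq> H \<and> norm (conj_mean h N w) \<le> \<delta>"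
proof -
  obtain N where N: "N \<ge> 1" "2 * norm w * sqrt (1 / real N) \<le> \<delta>"
    using ex_large_count[OF \<delta>, of "norm w" 1] by auto
  have F: "F \<subseteq> carrier G" and H: "H \<subseteq> carrier G" using P by (auto simp: powers_set_def)
  obtain h T where h: "h ` {1..N} \<subseteq> H" and T: "disjoint_family_on T {1..N}"
    and large: "\<And>j. j \<in> {1..N} \<Longrightarrow> large_set G {h j \<otimes> f \<otimes> inv (h j) | f. f \<in> F} (T j)"
  proof -
    have "\<exists>h T. h ` {1..N} \<subseteq> H \<and> disjoint_family_on T {1..N} \<and>
        (\<forall>j\<in>{1..N}. large_set G {h j \<otimes> f \<otimes> inv (h j) | f. f \<in> F} (T j))"
      using P N(1) unfolding powers_set_def by simp
    with that show thesis by blast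
  qed
  \<comment> \<open>The sets \<open>T j\<close> are already disjoint, so a single layer suffices,
    with \<open>{0}\<close> as a dummy index set.\<close>
  have "norm (conj_mean h N w) \<le> 2 * norm w * sqrt (real (card {0::nat}) / real N)"
  proof (rule norm_conj_mean_le[OF N(1) _ _ w, of _ _ "\<lambda>j k. T j"])
    show "h ` {1..N} \<subseteq> carrier G" using h H by blast
    fix j k assume j: "j \<in> {1..N}"
    show "T j \<subseteq> carrier G" using large[OF j] by (simp add: large_set_def)
    fix f u assume f: "f \<in> F" and u: "u \<in> carrier G - (\<Union>k\<in>{0::nat}. T j)"
    have "(h j \<otimes> f \<otimes> inv (h j)) <# (carrier G - T j) \<subseteq> T j"
      using large[OF j] f unfolding large_set_def by blast
    then show "h j \<otimes> f \<otimes> inv (h j) \<otimes> u \<in> (\<Union>k\<in>{0::nat}. T j)"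
      using u unfolding l_coset_def by auto
  qed (use F T in \<open>auto simp: disjoint_family_on_def\<close>)
  with N(2) have "norm (conj_mean h N w) \<le> \<delta>" by simp
  with N(1) h show ?thesis by blast
qed

text \<open>
  The group elements are treated one at a time, in the order of the chain: the conjugates of the
  next one by the elements used so far form a set to which its c-Powers set applies, and further
  averaging does not increase the norms of the parts already made small.
\<close>

lemma PH_averaging:
  assumes G: "PH_group G" and F: "finite F" "F \<noteq> {}" "F \<subseteq> carrier G - {\<one>}"
    and v: "v \<in> supp_span F" and \<delta>: "\<delta> > 0"
  shows "\<exists>\<Psi>. linear \<Psi> \<and> (\<forall>x. \<Psi> x \<in> conj_hull x) \<and> norm (\<Psi> v) \<le> \<delta>"
proof -
  from G F obtain n :: nat and f K where
    f: "bij_betw f {1..n} F" and K: "\<And>j. j \<in> {1..n} \<Longrightarrow> subgroup (K j) G"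
    and chain: "\<And>j. j \<in> {1..<n} \<Longrightarrow> K j \<subseteq> K (Suc j)"
    and cP: "\<And>j. j \<in> {1..n} \<Longrightarrow> c_powers_set G (f j) (K j)"
    unfolding PH_group_def by metis
  have Feq: "F = (\<Union>i\<in>{1..n}. {f i})" using f by (auto simp: bij_betw_def)
  have fc: "f i \<in> carrier G" if "i \<in> {1..n}" for i using F(3) bij_betwE[OF f] that by blast
  obtain w where w: "\<And>i. i \<in> {1..n} \<Longrightarrow> w i \<in> supp_span {f i}" "v = sum w {1..n}"
    using supp_span_UN[OF finite_atLeastAtMost v[unfolded Feq]] by blast
  have n: "n \<ge> 1" using F(2) Feq by (cases n) auto
  define \<epsilon> where "\<epsilon> = \<delta> / real n"
  have \<epsilon>: "\<epsilon> > 0" using \<delta> n by (simp add: \<epsilon>_def)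
  \<comment> \<open>\<open>M\<close> collects the group elements used so far. It lies in the next
    subgroup, so the c-Powers condition for \<open>f (Suc j)\<close> applies to the conjugates by
    \<open>M\<close>; for \<open>j = n\<close> there is no next subgroup.\<close>
  have "\<exists>\<Psi> M. linear \<Psi> \<and> (\<forall>x. \<Psi> x \<in> conj_hull x) \<and> finite M \<and> M \<noteq> {} \<and> M \<subseteq> carrier G \<and>
      (j < n \<longrightarrow> M \<subseteq> K (Suc j)) \<and>
      (\<forall>g\<in>carrier G. \<forall>x\<in>supp_span {g}. \<Psi> x \<in> supp_span (conjugates G g M)) \<and>
      (\<forall>i\<in>{1..j}. norm (\<Psi> (w i)) \<le> \<epsilon>)" if "j \<le> n" for j
    using that
  proof (induction j)
    case 0
    \<comment> \<open>The identity map is paired with \<open>{\<one>}\<close>, because the c-Powers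
      condition speaks of non-empty sets only.\<close>
    have "conjugates G g {\<one>} = {g}" if "g \<in> carrier G" for g
      using that by (auto simp: conjugates_def)
    moreover have "\<one> \<in> K (Suc 0)" using K[of 1] n by (simp add: subgroup.one_closed)
    ultimately show ?case
      by (intro exI[of _ id] exI[of _ "{\<one>}"]) (simp add: linear_id linear_ident self_in_conj_hull)
  next
    case (Suc j)
    then obtain \<Psi> M where \<Psi>: "linear \<Psi>" "\<And>x. \<Psi> x \<in> conj_hull x"
      and M: "finite M" "M \<noteq> {}" "M \<subseteq> K (Suc j)"
      and \<Psi>M: "\<And>g x. g \<in> carrier G \<Longrightarrow> x \<in> supp_span {g} \<Longrightarrow> \<Psi> x \<in> supp_span (conjugates G g M)"
      and small: "\<And>i. i \<in> {1..j} \<Longrightarrow> norm (\<Psi> (w i)) \<le> \<epsilon>"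
      by (metis Suc_leD Suc_le_lessD)
    have j: "Suc j \<in> {1..n}" using Suc.prems by simp
    have sub: "subgroup (K (Suc j)) G" by (rule K[OF j])
    have Kc: "K (Suc j) \<subseteq> carrier G" by (rule subgroup.subset[OF sub])
    have "powers_set G (conjugates G (f (Suc j)) M) (K (Suc j))"
      using cP[OF j] M unfolding c_powers_set_def by blast
    from powers_set_averaging[OF this \<Psi>M[OF fc[OF j] w(1)[OF j]] \<epsilon>] obtain N h where
      N: "N \<ge> 1" and h: "h ` {1..N} \<subseteq> K (Suc j)" and new: "norm (conj_mean h N (\<Psi> (w (Suc j)))) \<le> \<epsilon>"
      by blast
    have hc: "h l \<in> carrier G" if "l \<in> {1..N}" for l using h Kc that by blast
    define \<Phi> where "\<Phi> = conj_mean h N \<circ> \<Psi>"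
    \<comment> \<open>Averaging after \<open>\<Psi>\<close> conjugates by products; these stay in
      \<open>K (Suc j)\<close> because it is a subgroup, and the chain carries them to the next
      one.\<close>
    define M' where "M' = (\<lambda>(l, m). h l \<otimes> m) ` ({1..N} \<times> M)"
    have mean: "conj_mean h N z \<in> conj_hull y" if "z \<in> conj_hull y" for y z
      using hc N that by (intro conj_mean_in_conj_hull) auto
    have M'K: "M' \<subseteq> K (Suc j)"
      using h M(3) subgroup.m_closed[OF sub] by (auto simp: M'_def)
    have "\<Phi> x \<in> supp_span (conjugates G g M')" if g: "g \<in> carrier G" and x: "x \<in> supp_span {g}" for g x
    proof -
      have cg: "conjugates G g M \<subseteq> carrier G"
        using g M(3) Kc by (auto simp: conjugates_def)
      have "lam (h l) * \<Psi> x * adj (lam (h l)) \<in> supp_span (conjugates G g M')" if l: "l \<in> {1..N}" for l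
      proof (rule supp_span_mono[OF _ supp_span_conj[OF hc[OF l] \<Psi>M[OF g x] cg]], clarify)
        fix y assume "y \<in> conjugates G g M"
        then obtain m where m: "m \<in> M" "y = m \<otimes> g \<otimes> inv m" by (auto simp: conjugates_def)
        have mc: "m \<in> carrier G" using m(1) M(3) Kc by auto
        have "h l \<otimes> y \<otimes> inv (h l) = (h l \<otimes> m) \<otimes> g \<otimes> inv (h l \<otimes> m)"
          using hc[OF l] mc g by (simp add: m(2) inv_mult_group m_assoc)
        moreover have "h l \<otimes> m \<in> M'" using l m(1) by (auto simp: M'_def)
        ultimately show "h l \<otimes> y \<otimes> inv (h l) \<in> conjugates G g M'"
          unfolding conjugates_def by blast
      qed
      then show ?thesis
        unfolding \<Phi>_def conj_mean_def comp_def by (intro supp_span_scale supp_span_sum)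
    qed
    moreover have "norm (\<Phi> (w i)) \<le> \<epsilon>" if i: "i \<in> {1..Suc j}" for i
    proof (cases "i = Suc j")
      case True
      then show ?thesis using new by (simp add: \<Phi>_def)
    next
      case False
      then have "norm (\<Psi> (w i)) \<le> \<epsilon>" using i by (intro small) auto
      moreover have "norm (\<Phi> (w i)) \<le> norm (\<Psi> (w i))"
        unfolding \<Phi>_def comp_def by (intro norm_conj_hull_le mean self_in_conj_hull)
      ultimately show ?thesis by simp
    qed
    moreover have "M' \<subseteq> K (Suc (Suc j))" if "Suc j < n"
      using M'K chain[of "Suc j"] that by auto
    moreover have "linear \<Phi>" unfolding \<Phi>_def by (rule linear_compose[OF \<Psi>(1) linear_conj_mean])
    moreover have "\<Phi> x \<in> conj_hull x" for x unfolding \<Phi>_def comp_def by (intro mean \<Psi>(2))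
    moreover have "finite M'" "M' \<noteq> {}" using M N by (auto simp: M'_def)
    ultimately show ?case using M'K Kc by (intro exI[of _ \<Phi>] exI[of _ M']) auto
  qed
  from this[OF order_refl] obtain \<Psi> where \<Psi>: "linear \<Psi>" "\<And>x. \<Psi> x \<in> conj_hull x"
    "\<And>i. i \<in> {1..n} \<Longrightarrow> norm (\<Psi> (w i)) \<le> \<epsilon>" by blast
  have "norm (\<Psi> v) = norm (\<Sum>i\<in>{1..n}. \<Psi> (w i))"
    by (simp add: w(2) linear_sum[OF \<Psi>(1)])
  also have "\<dots> \<le> (\<Sum>i\<in>{1..n}. \<epsilon>)" by (rule sum_norm_le) (rule \<Psi>(3))
  also have "\<dots> = \<delta>" using n by (simp add: \<epsilon>_def)
  finally show ?thesis using \<Psi> by blast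
qed

end

theorem theorem3p8:
  fixes G :: "('g, 'm) monoid_scheme"
    and \<alpha> :: "'g \<Rightarrow> 'a::unital_cstar_algebra \<Rightarrow> 'a"
    and \<sigma> :: "'g \<Rightarrow> 'g \<Rightarrow> 'a"
    and \<iota> :: "'a \<Rightarrow> 'b::unital_cstar_algebra"
    and lam :: "'g \<Rightarrow> 'b"
    and E :: "'b \<Rightarrow> 'a"
  assumes "twisted_cstar_system G \<alpha> \<sigma>"
    and "class_P G"
    and "reduced_crossed_product G \<alpha> \<sigma> \<iota> lam E"
  shows "property_DP E"
proof -
  interpret reduced_crossed_product G \<alpha> \<sigma> \<iota> lam E by (rule assms(3))
  show ?thesis
  proof (rule property_DP_if_averaging)
    fix F and v :: 'b and \<delta> :: real
    assume "finite F" "F \<noteq> {}" "F \<subseteq> carrier G - {\<one>\<^bsub>G\<^esub>}" "v \<in> supp_span F" "\<delta> > 0"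
    then show "\<exists>\<Psi>. linear \<Psi> \<and> (\<forall>x. \<Psi> x \<in> conj_hull x) \<and> norm (\<Psi> v) \<le> \<delta>"
      using assms(2) P_com_averaging PH_averaging unfolding class_P_def by blast
  qed
qed

end
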